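(* The extension complexity of the TSP polytope $\mathrm{TSP}(n)$ is $2^{\Omega(n^{1/2})}$.
   Context: Let $K_n=(V_n,E_n)$ be the complete graph on $n\geqslant 3$ vertices. A tour of $K_n$ is (the edge set of) a Hamiltonian cycle of $K_n$. For $F\subseteq E_n$, $\chi^F\in\mathbb{R}^{E_n}$ is the characteristic vector of $F$. The traveling salesman polytope (TSP polytope) is $\mathrm{TSP}(n)=\operatorname{conv}\{\chi^F\in\mathbb{R}^{E_n}\mid F\subseteq E_n \text{ is a tour of } K_n\}$. An extended formulation (EF) of a polytope $P \subseteq \mathbb{R}^d$ is a linear system $E^{=}x + F^{=}y = g^{=},\ E^{\leqslant}x + F^{\leqslant}y \leqslant g^{\leqslant}$ in variables $(x,y)\in\mathbb{R}^{d+k}$ (for some $k \geqslant 0$), with real matrices and real vectors as coefficients, such that $x\in P$ if and only if there exists $y\in\mathbb{R}^k$ such that $(x,y)$ satisfies the system. The size of an EF is its number of inequalities (equalities are not counted). The extension complexity of $P$ is the minimum size of an EF of $P$. "Is $2^{\Omega(n^{1/2})}$" means: is at least $2^{c\sqrt n}$ for some constant $c>0$ and all sufficiently large $n$. *)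

theory Defs
  imports "HOL-Analysis.Analysis" "HOL-Analysis.Finite_Function_Topology"
begin

text \<open>
  Vectors in \<open>\<real>\<^sup>I\<close>, for a finite index set \<open>I\<close>, are the finitely supported functions
  \<open>'a \<Rightarrow>\<^sub>0 real\<close> whose support lies in \<open>I\<close>. This type is a real vector space, so that
  \<^const>\<open>hull\<close> with \<^const>\<open>convex\<close> applies although \<open>I\<close> varies.
\<close>

definition coord_space :: "'a set \<Rightarrow> ('a \<Rightarrow>\<^sub>0 real) set" where
  "coord_space I = {x. Poly_Mapping.keys x \<subseteq> I}"

text \<open>Only used for finite \<open>F\<close>; the coordinate of \<open>char_vec F\<close> at \<open>e\<close> is 1 if \<open>e \<in> F\<close> and 0 otherwise.\<close>

definition char_vec :: "'a set \<Rightarrow> ('a \<Rightarrow>\<^sub>0 real)" where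
  "char_vec F = (\<Sum>e\<in>F. Poly_Mapping.single e 1)"

lemma lookup_char_vec:
  "finite F \<Longrightarrow> Poly_Mapping.lookup (char_vec F) e = (if e \<in> F then 1 else 0)"
  by (simp add: char_vec_def lookup_sum lookup_single when_def)

subsection \<open>Extended formulations\<close>

text \<open>
  A system \<open>A x + B y = g\<close>, \<open>A' x + B' y \<le> g'\<close> in variables \<open>x \<in> \<real>\<^sup>I\<close> and \<open>y \<in> \<real>\<^sup>k\<close>.
  Equations, inequalities and the coordinates of \<open>y\<close> are numbered from 0; coefficients whose
  indices are out of range are irrelevant.
\<close>

record 'a lin_system =
  num_aux :: nat
  num_eq :: nat
  num_ineq :: nat
  eq_x :: "nat \<Rightarrow> 'a \<Rightarrow> real"
  eq_y :: "nat \<Rightarrow> nat \<Rightarrow> real"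
  eq_rhs :: "nat \<Rightarrow> real"
  ineq_x :: "nat \<Rightarrow> 'a \<Rightarrow> real"
  ineq_y :: "nat \<Rightarrow> nat \<Rightarrow> real"
  ineq_rhs :: "nat \<Rightarrow> real"

definition satisfies :: "'a set \<Rightarrow> 'a lin_system \<Rightarrow> ('a \<Rightarrow>\<^sub>0 real) \<Rightarrow> (nat \<Rightarrow> real) \<Rightarrow> bool" where
  "satisfies I S x y \<longleftrightarrow>
     (\<forall>i<num_eq S.
        (\<Sum>e\<in>I. eq_x S i e * Poly_Mapping.lookup x e) + (\<Sum>j<num_aux S. eq_y S i j * y j)
          = eq_rhs S i) \<and>
     (\<forall>i<num_ineq S.
        (\<Sum>e\<in>I. ineq_x S i e * Poly_Mapping.lookup x e) + (\<Sum>j<num_aux S. ineq_y S i j * y j)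
          \<le> ineq_rhs S i)"

definition extended_formulation ::
  "'a set \<Rightarrow> ('a \<Rightarrow>\<^sub>0 real) set \<Rightarrow> 'a lin_system \<Rightarrow> bool" where
  "extended_formulation I P S \<longleftrightarrow>
     (\<forall>x\<in>coord_space I. x \<in> P \<longleftrightarrow> (\<exists>y. satisfies I S x y))"

text \<open>
  The minimum is attained whenever \<open>P\<close> is a polytope in \<open>\<real>\<^sup>I\<close>, since the convex hull of finitely many
  points has an extended formulation with one inequality per point.
\<close>

definition extension_complexity :: "'a set \<Rightarrow> ('a \<Rightarrow>\<^sub>0 real) set \<Rightarrow> nat" where
  "extension_complexity I P = (LEAST m. \<exists>S. extended_formulation I P S \<and> num_ineq S = m)"

subsection \<open>The traveling salesman polytope\<close>

text \<open>The vertices of the complete graph \<open>K\<^sub>n\<close> are \<open>0, \<dots>, n - 1\<close>; its edges are two-element sets.\<close>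

definition complete_edges :: "nat \<Rightarrow> nat set set" where
  "complete_edges n = {e. e \<subseteq> {..<n} \<and> card e = 2}"

definition is_tour :: "nat \<Rightarrow> nat set set \<Rightarrow> bool" where
  "is_tour n F \<longleftrightarrow> n \<ge> 3 \<and>
     (\<exists>vs. distinct vs \<and> set vs = {..<n} \<and> F = {{vs ! i, vs ! (Suc i mod n)} | i. i < n})"

definition TSP :: "nat \<Rightarrow> (nat set \<Rightarrow>\<^sub>0 real) set" where
  "TSP n = convex hull {char_vec F | F. F \<subseteq> complete_edges n \<and> is_tour n F}"

end

theory Submission
  imports Defs
begin

text \<open>
  Let a system with \<open>r\<close> inequalities project onto a polytope, and lift some points \<open>v\<close> of the polytope to
  solutions. A valid inequality that is tight somewhere is loose at \<open>v\<close> if and only if some row of the system is tight at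
  the lifts of all points where the inequality is tight, and loose at the lift of \<open>v\<close>: otherwise one could
  move from the barycentre of the tight lifts away from the lift of \<open>v\<close> and violate the inequality.
  Hence the support of the slack matrix is covered by \<open>r\<close> rectangles.

  For the tours we find inequalities indexed by \<open>a \<subseteq> {..<k}\<close> and tours indexed by \<open>b \<subseteq> {..<k}\<close>, where
  \<open>k\<close> is of order \<open>\<surd>n\<close>, such that the slack is 0 if \<open>a\<close> and \<open>b\<close> meet in one element and positive if they
  are disjoint. A rectangle without pairs of the first kind contains at most \<open>2 ^ k\<close> of the
  \<open>3 ^ k\<close> disjoint pairs (Kaibel and Weltge), so that about \<open>(3 / 2) ^ k\<close> rectangles are needed.
  The inequality is a penalised form of \<open>\<Sum>i\<in>a. b i - \<Sum>i<j\<in>a. b i * b j \<le> 1\<close>, with the values and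
  their products read off from a tour of a graph with \<open>O(k\<^sup>2)\<close> vertices.
\<close>

subsection \<open>Rectangles and disjoint pairs\<close>

definition disjoint_pairs :: "'a set set \<Rightarrow> 'a set set \<Rightarrow> ('a set \<times> 'a set) set" where
  "disjoint_pairs A B = {(a, b). a \<in> A \<and> b \<in> B \<and> a \<inter> b = {}}"

lemma finite_disjoint_pairs: "finite A \<Longrightarrow> finite B \<Longrightarrow> finite (disjoint_pairs A B)"
  by (rule finite_subset[of _ "A \<times> B"]) (auto simp: disjoint_pairs_def)

text \<open>Induction on \<open>U\<close>, splitting both families by membership of the new element
  \<open>x\<close>. Of the four combinations one has no disjoint pairs, and the other three regroup
  into two rectangles over \<open>U\<close>, so the bound only doubles.\<close>

lemma card_disjoint_pairs_rectangle:
  assumes "finite U" "A \<subseteq> Pow U" "B \<subseteq> Pow U"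
    and "\<And>a b. a \<in> A \<Longrightarrow> b \<in> B \<Longrightarrow> card (a \<inter> b) \<noteq> 1"
  shows "card (disjoint_pairs A B) \<le> 2 ^ card U"
  using assms
proof (induction U arbitrary: A B rule: finite_induct)
  case empty
  then have "disjoint_pairs A B \<subseteq> {({}, {})}" by (auto simp: disjoint_pairs_def)
  then show ?case using card_mono[of "{({}, {})}" "disjoint_pairs A B"] by simp
next
  case (insert x U)
  define A0 A1 where "A0 = {a \<in> A. x \<notin> a}" and "A1 = {a. x \<notin> a \<and> insert x a \<in> A}"
  define B0 B1 where "B0 = {b \<in> B. x \<notin> b}" and "B1 = {b. x \<notin> b \<and> insert x b \<in> B}"
  note defs = A0_def A1_def B0_def B1_def
  have sub: "A0 \<subseteq> Pow U" "A1 \<subseteq> Pow U" "B0 \<subseteq> Pow U" "B1 \<subseteq> Pow U"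
    using insert.prems(1,2) by (auto simp: defs)
  have fin: "finite A0" "finite A1" "finite B0" "finite B1"
    using sub[THEN finite_subset] \<open>finite U\<close> by simp_all
  note fin_dp = finite_disjoint_pairs
  \<comment> \<open>If \<open>a\<close> and \<open>b\<close> were disjoint, the sets with
    \<open>x\<close> put back would meet in \<open>x\<close> alone.\<close>
  have no_pairs: "disjoint_pairs A1 B1 = {}"
  proof -
    have "a \<inter> b \<noteq> {}" if "a \<in> A1" "b \<in> B1" for a b
      using insert.prems(3)[of "insert x a" "insert x b"] that by (auto simp: defs)
    then show ?thesis by (auto simp: disjoint_pairs_def)
  qed
  have split: "disjoint_pairs A B = disjoint_pairs A0 B0 \<union>
      (\<lambda>(a, b). (a, insert x b)) ` disjoint_pairs A0 B1 \<union>
      (\<lambda>(a, b). (insert x a, b)) ` disjoint_pairs A1 B0" (is "?D = ?D1 \<union> ?D2 \<union> ?D3")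
  proof
    show "?D \<subseteq> ?D1 \<union> ?D2 \<union> ?D3"
    proof
      fix p assume "p \<in> ?D"
      then obtain a b where p: "p = (a, b)" "a \<in> A" "b \<in> B" "a \<inter> b = {}"
        by (auto simp: disjoint_pairs_def)
      consider "x \<notin> a" "x \<notin> b" | "x \<notin> a" "x \<in> b" | "x \<in> a" "x \<notin> b" using p by blast
      then show "p \<in> ?D1 \<union> ?D2 \<union> ?D3"
      proof cases
        case 1 then show ?thesis using p by (auto simp: disjoint_pairs_def defs)
      next
        case 2
        then have "(a, b - {x}) \<in> disjoint_pairs A0 B1" "p = (a, insert x (b - {x}))"
          using p by (auto simp: disjoint_pairs_def defs insert_absorb)
        then show ?thesis by force
      next
        case 3
        then have "(a - {x}, b) \<in> disjoint_pairs A1 B0" "p = (insert x (a - {x}), b)"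
          using p by (auto simp: disjoint_pairs_def defs insert_absorb)
        then show ?thesis by force
      qed
    qed
  qed (auto simp: disjoint_pairs_def defs)
  have "card (disjoint_pairs A B) \<le>
      card (disjoint_pairs A0 B0) + card (disjoint_pairs A0 B1) + card (disjoint_pairs A1 B0)"
    unfolding split using card_Un_le[of "disjoint_pairs A0 B0 \<union> (\<lambda>(a, b). (a, insert x b)) ` disjoint_pairs A0 B1"
        "(\<lambda>(a, b). (insert x a, b)) ` disjoint_pairs A1 B0"]
      card_Un_le[of "disjoint_pairs A0 B0" "(\<lambda>(a, b). (a, insert x b)) ` disjoint_pairs A0 B1"]
      card_image_le[OF fin_dp[OF fin(1,4)], of "\<lambda>(a, b). (a, insert x b)"]
      card_image_le[OF fin_dp[OF fin(2,3)], of "\<lambda>(a, b). (insert x a, b)"] by linarith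
  \<comment> \<open>Inclusion-exclusion in the first factor. The term for
    \<open>A0 \<inter> A1\<close> is then merged with \<open>disjoint_pairs A0 B1\<close>: a common
    pair would lie in \<open>disjoint_pairs A1 B1\<close>.\<close>
  also have "card (disjoint_pairs A0 B0) + card (disjoint_pairs A1 B0) =
      card (disjoint_pairs (A0 \<union> A1) B0) + card (disjoint_pairs (A0 \<inter> A1) B0)"
  proof -
    have "disjoint_pairs A0 B0 \<union> disjoint_pairs A1 B0 = disjoint_pairs (A0 \<union> A1) B0"
      "disjoint_pairs A0 B0 \<inter> disjoint_pairs A1 B0 = disjoint_pairs (A0 \<inter> A1) B0"
      by (auto simp: disjoint_pairs_def)
    then show ?thesis using card_Un_Int[OF fin_dp[OF fin(1,3)] fin_dp[OF fin(2,3)]] by simp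
  qed
  then have "card (disjoint_pairs A0 B0) + card (disjoint_pairs A0 B1) + card (disjoint_pairs A1 B0) =
      card (disjoint_pairs (A0 \<union> A1) B0) +
      (card (disjoint_pairs (A0 \<inter> A1) B0) + card (disjoint_pairs A0 B1))"
    by simp
  also have "card (disjoint_pairs (A0 \<inter> A1) B0) + card (disjoint_pairs A0 B1) =
      card (disjoint_pairs (A0 \<inter> A1) B0 \<union> disjoint_pairs A0 B1)"
    using no_pairs fin by (intro card_Un_disjoint[symmetric] fin_dp) (auto simp: disjoint_pairs_def)
  also have "\<dots> \<le> card (disjoint_pairs A0 (B0 \<union> B1))"
    by (intro card_mono fin_dp finite_UnI fin) (auto simp: disjoint_pairs_def)
  finally have "card (disjoint_pairs A B) \<le>
      card (disjoint_pairs (A0 \<union> A1) B0) + card (disjoint_pairs A0 (B0 \<union> B1))" by simp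
  moreover have "card (disjoint_pairs (A0 \<union> A1) B0) \<le> 2 ^ card U"
  proof (rule insert.IH)
    \<comment> \<open>Putting \<open>x\<close> back into \<open>a\<close> does not change its
      intersection with a \<open>b\<close> that lacks \<open>x\<close>.\<close>
    show "card (a \<inter> b) \<noteq> 1" if "a \<in> A0 \<union> A1" "b \<in> B0" for a b
      using that insert.prems(3)[of a b] insert.prems(3)[of "insert x a" b] by (auto simp: defs)
  qed (use sub in auto)
  moreover have "card (disjoint_pairs A0 (B0 \<union> B1)) \<le> 2 ^ card U"
  proof (rule insert.IH)
    show "card (a \<inter> b) \<noteq> 1" if "a \<in> A0" "b \<in> B0 \<union> B1" for a b
      using that insert.prems(3)[of a b] insert.prems(3)[of a "insert x b"] by (auto simp: defs)
  qed (use sub in auto)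
  ultimately show ?case using insert.hyps by simp
qed

text \<open>Each element lies in the first set, in the second or in neither.\<close>

lemma card_disjoint_pairs_Pow:
  assumes "finite U"
  shows "card (disjoint_pairs (Pow U) (Pow U)) = 3 ^ card U"
  using assms
proof (induction U rule: finite_induct)
  case empty
  have "disjoint_pairs (Pow {}) (Pow {}) = {({} :: 'a set, {})}" by (auto simp: disjoint_pairs_def)
  then show ?case by simp
next
  case (insert x U)
  let ?D = "disjoint_pairs (Pow U) (Pow U)"
  have fin: "finite ?D" using insert by (auto intro: finite_disjoint_pairs)
  have split: "disjoint_pairs (Pow (insert x U)) (Pow (insert x U)) =
      ?D \<union> (\<lambda>(a, b). (a, insert x b)) ` ?D \<union> (\<lambda>(a, b). (insert x a, b)) ` ?D" (is "?L = ?R")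
  proof
    show "?L \<subseteq> ?R"
    proof
      fix p assume "p \<in> ?L"
      then obtain a b where p: "p = (a, b)" "a \<subseteq> insert x U" "b \<subseteq> insert x U" "a \<inter> b = {}"
        by (auto simp: disjoint_pairs_def)
      consider "x \<notin> a" "x \<notin> b" | "x \<notin> a" "x \<in> b" | "x \<in> a" "x \<notin> b" using p by blast
      then show "p \<in> ?R"
      proof cases
        case 1 then show ?thesis using p by (auto simp: disjoint_pairs_def)
      next
        case 2
        then have "(a, b - {x}) \<in> ?D" "p = (a, insert x (b - {x}))"
          using p by (auto simp: disjoint_pairs_def)
        then show ?thesis by force
      next
        case 3
        then have "(a - {x}, b) \<in> ?D" "p = (insert x (a - {x}), b)"
          using p by (auto simp: disjoint_pairs_def)
        then show ?thesis by force
      qed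
    qed
  qed (use insert.hyps in \<open>auto simp: disjoint_pairs_def\<close>)
  have x: "x \<notin> a" "x \<notin> b" if "(a, b) \<in> ?D" for a b
    using that insert.hyps by (auto simp: disjoint_pairs_def)
  define D2 D3 where "D2 = (\<lambda>(a, b). (a, insert x b)) ` ?D" and "D3 = (\<lambda>(a, b). (insert x a, b)) ` ?D"
  have "inj_on (\<lambda>(a, b). (a, insert x b)) ?D" "inj_on (\<lambda>(a, b). (insert x a, b)) ?D"
    by (intro inj_onI, clarsimp, metis x insert_ident)+
  then have "card D2 = card ?D" "card D3 = card ?D" by (simp_all add: D2_def D3_def card_image)
  moreover have "finite D2" "finite D3" using fin by (simp_all add: D2_def D3_def)
  moreover have "(?D \<union> D2) \<inter> D3 = {}" "?D \<inter> D2 = {}" using x by (auto simp: D2_def D3_def)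
  ultimately have "card (?D \<union> D2 \<union> D3) = 3 * card ?D"
    using fin card_Un_disjoint[of "?D \<union> D2" D3] card_Un_disjoint[of ?D D2] by (simp only: finite_Un)
  then show ?case
    using insert.IH insert.hyps unfolding split D2_def D3_def by simp
qed

lemma rectangle_cover_lower_bound:
  assumes "finite U" "finite J"
    and "\<And>j. j \<in> J \<Longrightarrow> R j \<subseteq> Pow U" "\<And>j. j \<in> J \<Longrightarrow> C j \<subseteq> Pow U"
    and "\<And>j a b. j \<in> J \<Longrightarrow> a \<in> R j \<Longrightarrow> b \<in> C j \<Longrightarrow> card (a \<inter> b) \<noteq> 1"
    and "\<And>a b. a \<subseteq> U \<Longrightarrow> b \<subseteq> U \<Longrightarrow> a \<inter> b = {} \<Longrightarrow> \<exists>j\<in>J. a \<in> R j \<and> b \<in> C j"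
  shows "(3 / 2 :: real) ^ card U \<le> card J"
proof -
  have "3 ^ card U \<le> card (\<Union>j\<in>J. disjoint_pairs (R j) (C j))"
    unfolding card_disjoint_pairs_Pow[OF assms(1), symmetric]
  proof (rule card_mono)
    show "finite (\<Union>j\<in>J. disjoint_pairs (R j) (C j))"
    proof (intro finite_UN_I \<open>finite J\<close> finite_disjoint_pairs)
      show "finite (R j)" "finite (C j)" if "j \<in> J" for j
        using assms(3,4)[OF that] assms(1) by (meson finite_Pow_iff finite_subset)+
    qed
    show "disjoint_pairs (Pow U) (Pow U) \<subseteq> (\<Union>j\<in>J. disjoint_pairs (R j) (C j))"
      using assms(6) by (fastforce simp: disjoint_pairs_def)
  qed
  also have "\<dots> \<le> (\<Sum>j\<in>J. card (disjoint_pairs (R j) (C j)))"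
    by (rule card_UN_le[OF \<open>finite J\<close>])
  also have "\<dots> \<le> (\<Sum>j\<in>J. 2 ^ card U)"
    by (intro sum_mono card_disjoint_pairs_rectangle assms(1,3,4,5))
  finally have "3 ^ card U \<le> card J * 2 ^ card U" by simp
  then have "(3::real) ^ card U \<le> card J * 2 ^ card U"
    by (metis of_nat_le_iff of_nat_mult of_nat_numeral of_nat_power)
  then show ?thesis by (simp add: power_divide field_simps)
qed

subsection \<open>Extended formulations\<close>

lemma lookup_scaleR [simp]:
  "Poly_Mapping.lookup (r *\<^sub>R x) e = r * Poly_Mapping.lookup x e"
proof -
  have "finite {i. r *\<^sub>R Poly_Mapping.lookup x i \<noteq> 0}"
    by (rule finite_subset[OF _ finite_lookup[of x]]) auto
  then show ?thesis by (simp add: scaleR_poly_mapping_def Poly_Mapping.lookup_Abs_poly_mapping)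
qed

lemma coord_space_sum:
  assumes "\<And>b. b \<in> B \<Longrightarrow> v b \<in> coord_space I"
  shows "(\<Sum>b\<in>B. w b *\<^sub>R v b) \<in> coord_space I"
proof -
  have "Poly_Mapping.lookup (\<Sum>b\<in>B. w b *\<^sub>R v b) e = 0" if "e \<notin> I" for e
    using assms that by (fastforce simp: lookup_sum coord_space_def in_keys_iff intro!: sum.neutral)
  then show ?thesis by (auto simp: coord_space_def in_keys_iff)
qed

definition pairing :: "'a set \<Rightarrow> ('a \<Rightarrow> real) \<Rightarrow> ('a \<Rightarrow>\<^sub>0 real) \<Rightarrow> real" where
  "pairing I c x = (\<Sum>e\<in>I. c e * Poly_Mapping.lookup x e)"

lemma pairing_sum: "pairing I c (\<Sum>b\<in>B. w b *\<^sub>R v b) = (\<Sum>b\<in>B. w b * pairing I c (v b))"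
  by (simp add: pairing_def lookup_sum sum_distrib_left sum.swap[of _ B] mult.left_commute)

lemma pairing_diff: "pairing I c (x - y) = pairing I c x - pairing I c y"
  by (simp add: pairing_def lookup_minus sum_subtractf right_diff_distrib)

lemma pairing_scaleR: "pairing I c (r *\<^sub>R x) = r * pairing I c x"
  by (simp add: pairing_def sum_distrib_left mult.left_commute)

definition system_row :: "'a set \<Rightarrow> nat \<Rightarrow> ('a \<Rightarrow> real) \<Rightarrow> (nat \<Rightarrow> real) \<Rightarrow> ('a \<Rightarrow>\<^sub>0 real) \<Rightarrow> (nat \<Rightarrow> real) \<Rightarrow> real" where
  "system_row I m p q x y = pairing I p x + (\<Sum>j<m. q j * y j)"

lemma satisfies_iff_system_row:
  "satisfies I S x y \<longleftrightarrow>
     (\<forall>i<num_eq S. system_row I (num_aux S) (eq_x S i) (eq_y S i) x y = eq_rhs S i) \<and>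
     (\<forall>i<num_ineq S. system_row I (num_aux S) (ineq_x S i) (ineq_y S i) x y \<le> ineq_rhs S i)"
  by (simp add: satisfies_def system_row_def pairing_def)

lemma system_row_combination:
  "system_row I m p q ((\<Sum>b\<in>B. w b *\<^sub>R v b) - t *\<^sub>R x) (\<lambda>j. (\<Sum>b\<in>B. w b * z b j) - t * y j) =
     (\<Sum>b\<in>B. w b * system_row I m p q (v b) (z b)) - t * system_row I m p q x y"
  by (simp add: system_row_def pairing_sum pairing_diff pairing_scaleR algebra_simps sum.distrib
      sum_subtractf sum_distrib_left sum.swap[of _ B])

text \<open>Row \<open>j\<close> yields the rectangle of the inequalities whose tight points all
  make it tight and the points that leave it slack. The point \<open>b'\<close> ensures that a
  barycentre of tight lifts exists; nothing is claimed for inequalities that are tight at no point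
  of \<open>B\<close>.\<close>

lemma extended_formulation_rectangles:
  assumes EF: "extended_formulation I P S"
    and fin: "finite B"
    and v: "\<And>b. b \<in> B \<Longrightarrow> v b \<in> P \<inter> coord_space I"
    and valid: "\<And>a x. a \<in> A \<Longrightarrow> x \<in> P \<inter> coord_space I \<Longrightarrow> pairing I (c a) x \<le> \<beta> a"
  obtains R C where "\<And>j. R j \<subseteq> A" "\<And>j. C j \<subseteq> B"
    "\<And>j a b. a \<in> R j \<Longrightarrow> b \<in> C j \<Longrightarrow> pairing I (c a) (v b) < \<beta> a"
    "\<And>a b b'. a \<in> A \<Longrightarrow> b \<in> B \<Longrightarrow> b' \<in> B \<Longrightarrow> pairing I (c a) (v b) < \<beta> a \<Longrightarrow>
       pairing I (c a) (v b') = \<beta> a \<Longrightarrow> \<exists>j<num_ineq S. a \<in> R j \<and> b \<in> C j"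
proof -
  have "\<exists>y. satisfies I S (v b) y" if "b \<in> B" for b
    using EF v[OF that] by (auto simp: extended_formulation_def)
  then obtain y where y: "\<And>b. b \<in> B \<Longrightarrow> satisfies I S (v b) (y b)" by metis
  let ?eq = "\<lambda>i. system_row I (num_aux S) (eq_x S i) (eq_y S i)"
  let ?ineq = "\<lambda>i. system_row I (num_aux S) (ineq_x S i) (ineq_y S i)"
  define \<sigma> where "\<sigma> i b = ineq_rhs S i - ?ineq i (v b) (y b)" for i b
  define G where "G a = {b \<in> B. pairing I (c a) (v b) = \<beta> a}" for a
  define R where "R j = {a \<in> A. \<forall>b\<in>G a. \<sigma> j b = 0}" for j
  define C where "C j = {b \<in> B. \<sigma> j b \<noteq> 0}" for j
  show thesis
  proof
    show "R j \<subseteq> A" "C j \<subseteq> B" for j by (auto simp: R_def C_def)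
    show "pairing I (c a) (v b) < \<beta> a" if "a \<in> R j" "b \<in> C j" for j a b
      using that valid[of a "v b"] v[of b] by (fastforce simp: R_def C_def G_def)
  next
    fix a b b'
    assume a: "a \<in> A" and b: "b \<in> B" and b': "b' \<in> B"
      and less: "pairing I (c a) (v b) < \<beta> a" and tight: "pairing I (c a) (v b') = \<beta> a"
    show "\<exists>j<num_ineq S. a \<in> R j \<and> b \<in> C j"
    proof (rule ccontr)
      assume none: "\<not> ?thesis"
      have finG: "finite (G a)" and GB: "G a \<subseteq> B" and "G a \<noteq> {}"
        using fin b' tight by (auto simp: G_def)
      define m where "m = real (card (G a))"
      have "m > 0" using finG \<open>G a \<noteq> {}\<close> by (simp add: m_def card_gt_0_iff)
      have nn: "\<sigma> j d \<ge> 0" if "j < num_ineq S" "d \<in> B" for j d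
        using y[OF that(2)] that(1) by (simp add: satisfies_iff_system_row \<sigma>_def)
      have sum_nn: "(\<Sum>d\<in>G a. \<sigma> j d) \<ge> 0" if "j < num_ineq S" for j
        using nn that GB by (auto intro!: sum_nonneg)
      \<comment> \<open>\<open>1 + K\<close> exceeds each ratio of the slack at \<open>b\<close> to
        the mean slack over \<open>G a\<close>, so a step of length \<open>t\<close> violates no
        such row. Rows with total slack 0 contribute 0 here, division by 0 being 0, and are treated
        separately below.\<close>
      define K where "K = (\<Sum>j<num_ineq S. m * \<sigma> j b / (\<Sum>d\<in>G a. \<sigma> j d))"
      define t where "t = 1 / (1 + K)"
      have "K \<ge> 0" unfolding K_def
        using nn[OF _ b] sum_nn \<open>m > 0\<close>
        by (subst sum_nonneg) (auto intro: divide_nonneg_nonneg)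
      then have "t > 0" by (simp add: t_def)
      \<comment> \<open>The point obtained by moving away from \<open>b\<close> through the barycentre of the tight lifts.\<close>
      define x where "x = (\<Sum>d\<in>G a. ((1 + t) / m) *\<^sub>R v d) - t *\<^sub>R v b"
      define z where "z i = (\<Sum>d\<in>G a. ((1 + t) / m) * y d i) - t * y b i" for i
      have total: "(\<Sum>d\<in>G a. (1 + t) / m * r) = (1 + t) * r" for r
        using \<open>m > 0\<close> by (simp add: m_def)
      have "satisfies I S x z" unfolding satisfies_iff_system_row
      proof (intro conjI allI impI)
        fix i assume i: "i < num_eq S"
        have "?eq i (v d) (y d) = eq_rhs S i" if "d \<in> B" for d
          using y[OF that] i by (simp add: satisfies_iff_system_row)
        then have "(\<Sum>d\<in>G a. (1 + t) / m * ?eq i (v d) (y d)) = (\<Sum>d\<in>G a. (1 + t) / m * eq_rhs S i)"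
          "?eq i (v b) (y b) = eq_rhs S i"
          using GB b by (auto simp only: intro!: sum.cong)
        then have "?eq i x z = (\<Sum>d\<in>G a. (1 + t) / m * eq_rhs S i) - t * eq_rhs S i"
          unfolding x_def z_def system_row_combination by (simp only:)
        then show "?eq i x z = eq_rhs S i" unfolding total by (simp add: algebra_simps)
      next
        fix j assume j: "j < num_ineq S"
        have "?ineq j x z = (\<Sum>d\<in>G a. (1 + t) / m * (ineq_rhs S j - \<sigma> j d)) - t * (ineq_rhs S j - \<sigma> j b)"
          unfolding x_def z_def system_row_combination by (simp add: \<sigma>_def)
        also have "\<dots> = (\<Sum>d\<in>G a. (1 + t) / m * ineq_rhs S j) - (1 + t) / m * (\<Sum>d\<in>G a. \<sigma> j d)
            - t * (ineq_rhs S j - \<sigma> j b)"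
          by (simp only: right_diff_distrib sum_subtractf sum_distrib_left)
        finally have eq: "?ineq j x z = ineq_rhs S j - (1 + t) / m * (\<Sum>d\<in>G a. \<sigma> j d) + t * \<sigma> j b"
          unfolding total by (simp add: algebra_simps)
        show "?ineq j x z \<le> ineq_rhs S j"
        proof (cases "(\<Sum>d\<in>G a. \<sigma> j d) = 0")
          case True
          \<comment> \<open>Here \<open>a \<in> R j\<close>, so the absence of a covering rectangle
            forces \<open>b \<notin> C j\<close>.\<close>
          then have "\<forall>d\<in>G a. \<sigma> j d = 0"
            using nn[OF j] GB finG by (subst (asm) sum_nonneg_eq_0_iff) auto
          then have "\<sigma> j b = 0" using none a b j by (auto simp: R_def C_def)
          then show ?thesis using eq True by simp
        next
          case False
          then have pos: "(\<Sum>d\<in>G a. \<sigma> j d) > 0" using sum_nn[OF j] by simp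
          have "m * \<sigma> j b / (\<Sum>d\<in>G a. \<sigma> j d) \<le> K" unfolding K_def
            using j nn[OF _ b] sum_nn \<open>m > 0\<close>
            by (intro member_le_sum divide_nonneg_nonneg mult_nonneg_nonneg) auto
          then have "m * \<sigma> j b / (\<Sum>d\<in>G a. \<sigma> j d) \<le> 1 + K" by simp
          then have "m * \<sigma> j b \<le> (1 + K) * (\<Sum>d\<in>G a. \<sigma> j d)"
            using pos by (simp add: pos_divide_le_eq)
          then have "t * \<sigma> j b \<le> 1 / m * (\<Sum>d\<in>G a. \<sigma> j d)"
            using \<open>m > 0\<close> \<open>K \<ge> 0\<close> by (simp add: t_def field_simps)
          also have "\<dots> \<le> (1 + t) / m * (\<Sum>d\<in>G a. \<sigma> j d)"
            using pos \<open>m > 0\<close> \<open>t > 0\<close> by (intro mult_right_mono divide_right_mono) auto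
          finally show ?thesis using eq by simp
        qed
      qed
      moreover have cs: "x \<in> coord_space I"
      proof -
        \<comment> \<open>The extra index \<open>None\<close> carries the subtracted term, which
          makes \<open>x\<close> a single linear combination.\<close>
        have "x = (\<Sum>d\<in>insert None (Some ` G a).
            (case d of None \<Rightarrow> - t | Some d \<Rightarrow> (1 + t) / m) *\<^sub>R (case d of None \<Rightarrow> v b | Some d \<Rightarrow> v d))"
          using finG by (simp add: x_def sum.reindex)
        then show ?thesis
          using v GB b by (auto intro!: coord_space_sum split: option.splits)
      qed
      ultimately have "x \<in> P" using EF by (auto simp: extended_formulation_def)
      then have "pairing I (c a) x \<le> \<beta> a" using valid a cs by blast
      \<comment> \<open>The weights on \<open>G a\<close> sum to \<open>1 + t\<close>, so
        \<open>x\<close> exceeds the bound by \<open>t\<close> times the slack of the inequality at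
        \<open>v b\<close>.\<close>
      moreover have "pairing I (c a) x = (1 + t) * \<beta> a - t * pairing I (c a) (v b)"
      proof -
        have "pairing I (c a) x = (\<Sum>d\<in>G a. (1 + t) / m * \<beta> a) - t * pairing I (c a) (v b)"
          by (simp add: x_def pairing_diff pairing_sum pairing_scaleR G_def)
        then show ?thesis unfolding total .
      qed
      moreover have "t * pairing I (c a) (v b) < t * \<beta> a"
        using less \<open>t > 0\<close> by simp
      ultimately show False by (simp add: algebra_simps)
    qed
  qed
qed

section \<open>Valid inequalities and an extended formulation for a convex hull\<close>

lemma pairing_le_convex_hull:
  assumes "\<And>x. x \<in> V \<Longrightarrow> pairing I c x \<le> \<beta>" and "x \<in> convex hull V"
  shows "pairing I c x \<le> \<beta>"
proof -
  have "convex {x. pairing I c x \<le> \<beta>}"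
  proof (rule convexI)
    fix x y and u w :: real
    assume *: "x \<in> {x. pairing I c x \<le> \<beta>}" "y \<in> {x. pairing I c x \<le> \<beta>}" "0 \<le> u" "0 \<le> w" "u + w = 1"
    have "pairing I c (u *\<^sub>R x + w *\<^sub>R y) = u * pairing I c x + w * pairing I c y"
      by (simp add: pairing_def lookup_add sum.distrib sum_distrib_left algebra_simps)
    also have "\<dots> \<le> u * \<beta> + w * \<beta>" using * by (intro add_mono mult_left_mono) auto
    finally show "u *\<^sub>R x + w *\<^sub>R y \<in> {x. pairing I c x \<le> \<beta>}"
      using * by (simp flip: distrib_right)
  qed
  then have "convex hull V \<subseteq> {x. pairing I c x \<le> \<beta>}" using assms(1) by (intro hull_minimal) auto
  then show ?thesis using assms(2) by auto
qed

lemma extended_formulation_convex_hull: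
  assumes "finite I" "finite V" "V \<subseteq> coord_space I"
  shows "\<exists>S. extended_formulation I (convex hull V) S"
proof -
  obtain h where h: "bij_betw h {..<card I} I"
    using ex_bij_betw_nat_finite[OF \<open>finite I\<close>] by (auto simp: atLeast0LessThan)
  obtain f where f: "bij_betw f {..<card V} V"
    using ex_bij_betw_nat_finite[OF \<open>finite V\<close>] by (auto simp: atLeast0LessThan)
  let ?l = Poly_Mapping.lookup
  \<comment> \<open>The auxiliary variables are convex weights. The first \<open>card I\<close>
    equations express \<open>x\<close> as the weighted sum of the points, one coordinate each; the
    equation with number \<open>card I\<close> fixes the total weight.\<close>
  define S :: "'a lin_system" where "S =
    \<lparr>num_aux = card V, num_eq = Suc (card I), num_ineq = card V,
     eq_x = (\<lambda>i e. if i < card I \<and> e = h i then 1 else 0),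
     eq_y = (\<lambda>i j. if i < card I then - ?l (f j) (h i) else 1),
     eq_rhs = (\<lambda>i. if i < card I then 0 else 1),
     ineq_x = (\<lambda>_ _. 0),
     ineq_y = (\<lambda>i j. if i = j then - 1 else 0),
     ineq_rhs = (\<lambda>_. 0)\<rparr>"
  have sat: "satisfies I S x y \<longleftrightarrow> (\<forall>e\<in>I. ?l x e = (\<Sum>j<card V. y j * ?l (f j) e)) \<and>
      sum y {..<card V} = 1 \<and> (\<forall>j<card V. 0 \<le> y j)" for x y
  proof -
    have eq: "(\<Sum>e\<in>I. ?l x e * (if e = h i then 1 else 0)) = ?l x (h i)" if "i < card I" for i
    proof -
      have "h i \<in> I" using h that by (auto simp: bij_betw_def)
      then show ?thesis using that \<open>finite I\<close> by (simp add: if_distrib[of "\<lambda>u. _ * u"] cong: if_cong)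
    qed
    have "(\<forall>i<Suc (card I). (\<Sum>e\<in>I. eq_x S i e * ?l x e) + (\<Sum>j<card V. eq_y S i j * y j) = eq_rhs S i) \<longleftrightarrow>
       (\<forall>i<card I. ?l x (h i) = (\<Sum>j<card V. y j * ?l (f j) (h i))) \<and> sum y {..<card V} = 1"
      by (auto simp: S_def less_Suc_eq all_conj_distrib eq sum_negf mult.commute)
    also have "(\<forall>i<card I. ?l x (h i) = (\<Sum>j<card V. y j * ?l (f j) (h i))) \<longleftrightarrow>
        (\<forall>e\<in>I. ?l x e = (\<Sum>j<card V. y j * ?l (f j) e))"
      using h by (force simp: bij_betw_def)
    finally show ?thesis
      by (simp add: satisfies_def S_def if_distrib[of "\<lambda>u. u * _"] cong: if_cong)
  qed
  have "extended_formulation I (convex hull V) S" unfolding extended_formulation_def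
  proof (intro ballI)
    fix x assume x: "x \<in> coord_space I"
    have lookup_zero: "?l w e = 0" if "e \<notin> I" "w \<in> coord_space I" for e w
      using that by (auto simp: coord_space_def in_keys_iff)
    \<comment> \<open>The equations control the coordinates in \<open>I\<close> only; outside
      \<open>I\<close> both sides vanish.\<close>
    have agree: "(\<Sum>j<card V. y j *\<^sub>R f j) = x" if "\<forall>e\<in>I. ?l x e = (\<Sum>j<card V. y j * ?l (f j) e)" for y
    proof (rule poly_mapping_eqI)
      fix e show "?l (\<Sum>j<card V. y j *\<^sub>R f j) e = ?l x e"
      proof (cases "e \<in> I")
        case False
        have "(\<Sum>j<card V. y j *\<^sub>R f j) \<in> coord_space I"
          using f assms(3) by (intro coord_space_sum) (auto simp: bij_betw_def)
        then show ?thesis using False x by (simp add: lookup_zero)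
      qed (use that in \<open>simp add: lookup_sum\<close>)
    qed
    have reindex: "(\<Sum>j<card V. g (f j)) = sum g V" for g :: "('a \<Rightarrow>\<^sub>0 real) \<Rightarrow> 'b::comm_monoid_add"
      by (rule sum.reindex_bij_betw[OF f])
    show "x \<in> convex hull V \<longleftrightarrow> (\<exists>y. satisfies I S x y)"
    proof
      assume "x \<in> convex hull V"
      then obtain u where u: "\<forall>w\<in>V. 0 \<le> u w" "sum u V = 1" "(\<Sum>w\<in>V. u w *\<^sub>R w) = x"
        unfolding convex_hull_finite[OF \<open>finite V\<close>] by auto
      have "\<forall>e\<in>I. ?l x e = (\<Sum>j<card V. u (f j) * ?l (f j) e)"
        unfolding u(3)[symmetric] by (simp add: lookup_sum reindex[of "\<lambda>w. u w * ?l w _"])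
      moreover have "\<forall>j<card V. 0 \<le> u (f j)" using u(1) f by (auto simp: bij_betw_def)
      ultimately have "satisfies I S x (u \<circ> f)"
        using u(2) reindex[of u] by (simp add: sat)
      then show "\<exists>y. satisfies I S x y" by blast
    next
      assume "\<exists>y. satisfies I S x y"
      then obtain y where y: "\<forall>e\<in>I. ?l x e = (\<Sum>j<card V. y j * ?l (f j) e)"
        "sum y {..<card V} = 1" "\<forall>j<card V. 0 \<le> y j" by (auto simp: sat)
      have "(\<Sum>j<card V. y j *\<^sub>R f j) \<in> convex hull V"
        using y(2,3) f by (intro convex_sum convex_convex_hull) (auto simp: bij_betw_def intro!: hull_inc)
      then show "x \<in> convex hull V" using agree[OF y(1)] by simp
    qed
  qed
  then show ?thesis ..
qed

subsection \<open>Tours\<close>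

text \<open>Replaces the list and \<open>mod\<close> by a bijection \<open>f\<close> from positions
  to vertices and a cyclic successor \<open>s\<close>, which are easier to handle.\<close>

lemma tour_rotation:
  assumes "is_tour n F"
  obtains f s where "bij_betw f {..<n} {..<n}" "\<And>i. s i = (if Suc i = n then 0 else Suc i)"
    "F = (\<lambda>i. {f i, f (s i)}) ` {..<n}"
proof -
  obtain vs where vs: "distinct vs" "set vs = {..<n}"
    and F: "F = {{vs ! i, vs ! (Suc i mod n)} | i. i < n}"
    using assms by (auto simp: is_tour_def)
  have "length vs = n" using vs distinct_card[OF vs(1)] by simp
  then have bij: "bij_betw ((!) vs) {..<n} {..<n}" using vs by (intro bij_betw_nth) auto
  have "F = (\<lambda>i. {vs ! i, vs ! (Suc i mod n)}) ` {..<n}"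
    unfolding F by (rule Setcompr_eq_image[of _ "{..<n}", unfolded lessThan_iff])
  then have "F = (\<lambda>i. {vs ! i, vs ! (if Suc i = n then 0 else Suc i)}) ` {..<n}"
    by (auto simp only: lessThan_iff mod_Suc mod_less intro!: image_cong)
  with bij show thesis by (intro that[of "(!) vs" "\<lambda>i. if Suc i = n then 0 else Suc i"]) auto
qed

text \<open>The neighbours sit at the cyclic successor and predecessor positions, which differ
  because \<open>n \<ge> 3\<close>.\<close>

lemma card_tour_neighbours:
  assumes "is_tour n F" and "u < n"
  shows "card {v. {u, v} \<in> F} = 2" "{v. {u, v} \<in> F} \<subseteq> {..<n} - {u}"
proof -
  obtain f s where f: "bij_betw f {..<n} {..<n}" and s: "\<And>i. s i = (if Suc i = n then 0 else Suc i)"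
    and F: "F = (\<lambda>i. {f i, f (s i)}) ` {..<n}"
    using tour_rotation[OF assms(1)] by blast
  have n: "n \<ge> 3" using assms(1) by (simp add: is_tour_def)
  have "u \<in> f ` {..<n}" using f \<open>u < n\<close> by (simp add: bij_betw_def)
  then obtain i where i: "i < n" "u = f i" by auto
  define p where "p = (if i = 0 then n - 1 else i - 1)"
  have inj: "f x = f y \<longleftrightarrow> x = y" if "x < n" "y < n" for x y
    using f that by (auto simp: bij_betw_def inj_on_def)
  have lt: "s j < n" if "j < n" for j using that n by (auto simp: s)
  have p: "p < n" "s p = i" "p \<noteq> i" "s i \<noteq> i" "p \<noteq> s i" using i n by (auto simp: p_def s)
  have sp: "s j = i \<longleftrightarrow> j = p" if "j < n" for j using that i n by (auto simp: p_def s)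
  have "{v. {u, v} \<in> F} = {f (s i), f p}"
  proof (rule set_eqI)
    fix v
    have "{u, v} \<in> F \<longleftrightarrow> (\<exists>j<n. u = f j \<and> v = f (s j) \<or> u = f (s j) \<and> v = f j)"
      unfolding F by (auto simp: doubleton_eq_iff)
    also have "\<dots> \<longleftrightarrow> (\<exists>j<n. j = i \<and> v = f (s j) \<or> j = p \<and> v = f j)"
      using i inj lt sp by metis
    finally show "v \<in> {v. {u, v} \<in> F} \<longleftrightarrow> v \<in> {f (s i), f p}" using i p by auto
  qed
  moreover have "f (s i) \<noteq> f p" "f (s i) \<noteq> u" "f p \<noteq> u" using inj i p lt by metis+
  moreover have "f (s i) < n" "f p < n" using f i lt p by (auto simp: bij_betw_def)
  ultimately show "card {v. {u, v} \<in> F} = 2" "{v. {u, v} \<in> F} \<subseteq> {..<n} - {u}" by auto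
qed

text \<open>Walk around the tour: a nonempty set that is never left in the direction of the walk
  contains every vertex.\<close>

lemma tour_crosses_cut:
  assumes "is_tour n F" and "W \<subset> {..<n}" "W \<noteq> {}"
  obtains u v where "u \<in> W" "v \<in> {..<n} - W" "{u, v} \<in> F"
proof -
  obtain f s where f: "bij_betw f {..<n} {..<n}" and s: "\<And>i. s i = (if Suc i = n then 0 else Suc i)"
    and F: "F = (\<lambda>i. {f i, f (s i)}) ` {..<n}"
    using tour_rotation[OF assms(1)] by blast
  have surj: "\<exists>i<n. x = f i" if "x < n" for x
  proof -
    have "x \<in> f ` {..<n}" using f that by (simp add: bij_betw_def)
    then show ?thesis by auto
  qed
  have ran: "f i < n" if "i < n" for i using f that by (auto simp: bij_betw_def)
  have "\<exists>i<n. f i \<in> W \<and> f (s i) \<notin> W"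
  proof (rule ccontr)
    assume closed: "\<not> ?thesis"
    obtain i where i: "i < n" "f i \<in> W" using assms(2,3) surj by (metis ex_in_conv lessThan_iff psubsetD)
    have step: "Suc j < n \<Longrightarrow> f j \<in> W \<Longrightarrow> f (Suc j) \<in> W" for j
      using closed s[of j] by (metis Suc_lessD nat_less_le)
    have up: "f j \<in> W" if "m \<le> j" "j < n" "f m \<in> W" for m j
      using that by (induction j rule: dec_induct) (auto intro: step)
    have "f (n - 1) \<in> W" using up[of i "n - 1"] i by simp
    then have "f 0 \<in> W" using closed s[of "n - 1"] i by auto
    then have "f j \<in> W" if "j < n" for j using up[of 0 j] that by simp
    then have "{..<n} \<subseteq> W" using surj by auto
    then show False using assms(2) by auto
  qed
  then obtain i where "i < n" "f i \<in> W" "f (s i) \<notin> W" by blast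
  moreover have "f (s i) < n" using \<open>i < n\<close> by (intro ran) (auto simp: s)
  ultimately show thesis using that[of "f i" "f (s i)"] by (auto simp: F)
qed

text \<open>Moves a cyclic arrangement of any vertex type into the numbered complete graph.
  \<open>ok\<close> stands for whatever consecutive entries satisfy, so that properties of
  \<open>L\<close> survive as properties of the edges of the tour.\<close>

lemma tour_of_list:
  assumes "n \<ge> 3" and bij: "bij_betw code V {..<n}"
    and L: "distinct L" "set L = V"
    and ok: "successively ok L" "ok (last L) (hd L)"
    and sym: "\<And>u v. ok u v \<Longrightarrow> ok v u"
  obtains F where "is_tour n F" "F \<subseteq> complete_edges n"
    "\<And>u v. u \<in> V \<Longrightarrow> v \<in> V \<Longrightarrow> {code u, code v} \<in> F \<Longrightarrow> ok u v"
proof -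
  have len: "length L = n" using L bij_betw_same_card[OF bij] distinct_card[OF L(1)] by simp
  let ?vs = "map code L"
  define F where "F = {{?vs ! i, ?vs ! (Suc i mod n)} | i. i < n}"
  have inj: "code u = code v \<longleftrightarrow> u = v" if "u \<in> V" "v \<in> V" for u v
    using that bij by (auto simp: bij_betw_def inj_on_def)
  have dist: "distinct ?vs" "set ?vs = {..<n}"
    using L bij by (auto simp: distinct_map bij_betw_def)
  show thesis
  proof
    show "is_tour n F" unfolding is_tour_def F_def using dist \<open>n \<ge> 3\<close> by blast
    show "F \<subseteq> complete_edges n"
    proof
      fix e assume "e \<in> F"
      then obtain i where i: "i < n" "e = {?vs ! i, ?vs ! (Suc i mod n)}" by (auto simp: F_def)
      have "Suc i mod n < n" "Suc i mod n \<noteq> i" using \<open>n \<ge> 3\<close> \<open>i < n\<close> by (auto simp: mod_Suc)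
      then have "?vs ! i \<noteq> ?vs ! (Suc i mod n)" "?vs ! i < n" "?vs ! (Suc i mod n) < n"
        using dist(2) len i nth_eq_iff_index_eq[OF dist(1), of i "Suc i mod n"]
          nth_mem[of i ?vs] nth_mem[of "Suc i mod n" ?vs] by (simp_all del: nth_map)
      then show "e \<in> complete_edges n" by (auto simp: i complete_edges_def)
    qed
  next
    fix u v assume u: "u \<in> V" and v: "v \<in> V" and "{code u, code v} \<in> F"
    then obtain i where i: "i < n" "{code u, code v} = {?vs ! i, ?vs ! (Suc i mod n)}"
      by (auto simp: F_def)
    define j where "j = Suc i mod n"
    have j: "j < n" using i by (simp add: j_def)
    have "L ! i \<in> V" "L ! j \<in> V" using L(2) len i(1) j nth_mem[of i L] nth_mem[of j L] by simp_all
    moreover have "{code u, code v} = {code (L ! i), code (L ! j)}" using i len j by (simp add: j_def)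
    ultimately have "u = L ! i \<and> v = L ! j \<or> v = L ! i \<and> u = L ! j"
      using u v by (simp only: doubleton_eq_iff inj) blast
    moreover have "ok (L ! i) (L ! j)"
    proof (cases "Suc i = n")
      case True
      moreover have "L \<noteq> []" using len i(1) by auto
      ultimately have "last L = L ! i" "hd L = L ! j" using len
        by (auto simp: last_conv_nth hd_conv_nth j_def)
      then show ?thesis using ok(2) by simp
    next
      case False
      then show ?thesis using ok(1) i len by (simp add: successively_conv_nth j_def)
    qed
    ultimately show "ok u v" using sym by blast
  qed
qed

subsection \<open>The gadget graph\<close>

text \<open>
  A variable \<open>i < k\<close> is represented by the row \<open>Start i, Enter i 0, Exit i 0, \<dots>, Enter i (k - 1), Exit i (k - 1)\<close>.
  It has the value 0 if a tour uses the edges between consecutive columns, and 1 if it does not.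
  The crossing of rows \<open>i < l\<close> consists of \<open>Enter\<close> and \<open>Exit\<close> at \<open>(i, l)\<close> and \<open>(l, i)\<close>;
  the rungs \<open>Enter i l - Exit l i\<close> and \<open>Enter l i - Exit i l\<close> are compulsory, so if both variables are 1
  the crossing closes up to a 4-cycle, unless it is inserted into the backbone
  \<open>Junc_in 0, Junc_out 0, Junc_in 1, \<dots>\<close> between \<open>Junc_out (i * k + l)\<close> and \<open>Junc_in (i * k + l + 1)\<close>.
  For \<open>i = l\<close> the rung coincides with the edge inside the row.
\<close>

datatype vertex = Enter nat nat | Exit nat nat | Start nat | Junc_in nat | Junc_out nat | Pad nat

fun left :: "nat \<Rightarrow> nat \<Rightarrow> vertex" where
  "left i 0 = Start i"
| "left i (Suc l) = Exit i l"

text \<open>The \<open>Pad\<close> vertices bring the number of vertices up to any prescribed larger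
  value.\<close>

definition verts :: "nat \<Rightarrow> nat \<Rightarrow> vertex set" where
  "verts k p = case_prod Enter ` ({..<k} \<times> {..<k}) \<union> case_prod Exit ` ({..<k} \<times> {..<k}) \<union>
     Start ` {..<k} \<union> Junc_in ` {..k * k} \<union> Junc_out ` {..k * k} \<union> Pad ` {..<p}"

lemma in_verts [simp]:
  "Enter i l \<in> verts k p \<longleftrightarrow> i < k \<and> l < k"
  "Exit i l \<in> verts k p \<longleftrightarrow> i < k \<and> l < k"
  "Start i \<in> verts k p \<longleftrightarrow> i < k"
  "Junc_in g \<in> verts k p \<longleftrightarrow> g \<le> k * k"
  "Junc_out g \<in> verts k p \<longleftrightarrow> g \<le> k * k"
  "Pad r \<in> verts k p \<longleftrightarrow> r < p"
  by (auto simp: verts_def)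

lemma card_verts: "card (verts k p) = 4 * k\<^sup>2 + k + 2 + p" and finite_verts: "finite (verts k p)"
proof -
  have inj: "inj_on (case_prod Enter) A" "inj_on (case_prod Exit) A" for A
    by (auto intro!: inj_onI)
  have inj': "inj_on Start B" "inj_on Junc_in B" "inj_on Junc_out B" "inj_on Pad B" for B
    by (auto intro!: inj_onI)
  have "card (A1 \<union> A2 \<union> A3 \<union> A4 \<union> A5 \<union> A6) = card A1 + card A2 + card A3 + card A4 + card A5 + card A6"
    if "finite A1" "finite A2" "finite A3" "finite A4" "finite A5" "finite A6"
      "A1 \<inter> A2 = {}" "(A1 \<union> A2) \<inter> A3 = {}" "(A1 \<union> A2 \<union> A3) \<inter> A4 = {}"
      "(A1 \<union> A2 \<union> A3 \<union> A4) \<inter> A5 = {}" "(A1 \<union> A2 \<union> A3 \<union> A4 \<union> A5) \<inter> A6 = {}"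
    for A1 A2 A3 A4 A5 A6 :: "vertex set"
    using that by (simp add: card_Un_disjoint)
  note union = this
  show "card (verts k p) = 4 * k\<^sup>2 + k + 2 + p"
    unfolding verts_def
    by (subst union) (auto simp: card_image inj inj' power2_eq_square)
  show "finite (verts k p)" by (simp add: verts_def)
qed

text \<open>An edge has to be allowed at both ends, so a restriction such as
  \<open>i \<le> l\<close> may be stated at one end only. \<open>UNIV\<close> occurs at the ends of
  rows and of the backbone and at the padding, where the pieces of a tour may be joined
  freely.\<close>

fun allowed :: "nat \<Rightarrow> vertex \<Rightarrow> vertex set" where
  "allowed k (Enter i l) = {Exit l i, Exit i l, left i l} \<union> (if i \<le> l then {Junc_out (i * k + l)} else {})"
| "allowed k (Exit i l) =
     (if Suc l < k
      then {Enter l i, Enter i l, Enter i (Suc l)} \<union> (if i \<le> l then {Junc_in (Suc (i * k + l))} else {})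
      else UNIV)"
| "allowed k (Junc_out g) =
     (if g < k * k then {Junc_in g, Junc_in (Suc g), Enter (g div k) (g mod k)} else UNIV)"
| "allowed k (Junc_in 0) = UNIV"
| "allowed k (Junc_in (Suc g)) = {Junc_out (Suc g), Junc_out g, Exit (g div k) (g mod k)}"
| "allowed k (Start i) = UNIV"
| "allowed k (Pad r) = UNIV"

text \<open>A crossing is encoded by the index with its smaller row first; the other values of
  \<open>g\<close> never carry a detour.\<close>

abbreviation escapes :: "nat \<Rightarrow> nat set \<Rightarrow> nat \<Rightarrow> bool" where
  "escapes k b g \<equiv> g div k \<le> g mod k \<and> g div k \<in> b \<and> g mod k \<in> b"

text \<open>The neighbours a vertex may have in the tour of the 0/1-assignment with support \<open>b\<close>.\<close>

fun followed :: "nat \<Rightarrow> nat set \<Rightarrow> vertex \<Rightarrow> vertex set" where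
  "followed k b (Enter i l) = {Exit l i,
     if i \<in> b then if i \<le> l \<and> l \<in> b then Junc_out (i * k + l) else Exit i l else left i l}"
| "followed k b (Exit i l) =
     (if i \<in> b then {Enter l i, if i \<le> l \<and> l \<in> b then Junc_in (Suc (i * k + l)) else Enter i l}
      else if Suc l < k then {Enter l i, Enter i (Suc l)} else UNIV)"
| "followed k b (Junc_out g) =
     (if g < k * k then {Junc_in g, if escapes k b g then Enter (g div k) (g mod k) else Junc_in (Suc g)}
      else UNIV)"
| "followed k b (Junc_in 0) = UNIV"
| "followed k b (Junc_in (Suc g)) =
     {Junc_out (Suc g), if escapes k b g then Exit (g div k) (g mod k) else Junc_out g}"
| "followed k b (Start i) = UNIV"
| "followed k b (Pad r) = UNIV"

lemma followed_subset_allowed: "followed k b u \<subseteq> allowed k u"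
  by (cases "(k, u)" rule: allowed.cases) auto

lemma pair_index:
  assumes "i < k" "l < (k::nat)"
  shows "(i * k + l) div k = i" "(i * k + l) mod k = l" "i * k + l < k * k"
proof -
  show "(i * k + l) div k = i" "(i * k + l) mod k = l" using assms by auto
  have "i * k + l < Suc i * k" using assms by simp
  also have "\<dots> \<le> k * k" using assms by (intro mult_right_mono) auto
  finally show "i * k + l < k * k" .
qed

section \<open>Local structure of tours in the gadget graph\<close>

locale two_factor =
  fixes k p :: nat and N :: "vertex \<Rightarrow> vertex set"
  assumes card_N: "u \<in> verts k p \<Longrightarrow> card (N u) = 2"
    and N_sym: "u \<in> verts k p \<Longrightarrow> v \<in> verts k p \<Longrightarrow> v \<in> N u \<Longrightarrow> u \<in> N v"
begin

lemma other_neighbour: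
  assumes "u \<in> verts k p" "v \<in> N u"
  obtains w where "w \<noteq> v" "N u = {v, w}"
proof -
  obtain x y where "N u = {x, y}" "x \<noteq> y" using card_N[OF assms(1)] by (auto simp: card_2_iff)
  then show thesis using assms(2) that[of x] that[of y] by (cases "v = x") auto
qed

lemma N_eqI:
  assumes "u \<in> verts k p" "v \<in> N u" "w \<in> N u" "v \<noteq> w"
  shows "N u = {v, w}"
proof -
  obtain x where "N u = {v, x}" using other_neighbour[OF assms(1,2)] by blast
  then show ?thesis using assms(3,4) by auto
qed

lemma N_eq_supset:
  assumes "u \<in> verts k p" "N u \<subseteq> {v, w}"
  shows "N u = {v, w}"
proof -
  have "card {v, w} \<le> 2" by (simp add: card_insert_if)
  then show ?thesis using card_N[OF assms(1)] card_seteq[of "{v, w}" "N u"] assms(2) by simp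
qed

end

text \<open>The tours in which the gadgets work as intended. \<open>connected\<close> forbids
  subtours.\<close>

locale regular_tour = two_factor +
  assumes N_allowed: "u \<in> verts k p \<Longrightarrow> N u \<subseteq> allowed k u"
    and rung: "i < k \<Longrightarrow> l < k \<Longrightarrow> Exit l i \<in> N (Enter i l)"
    and junction: "g \<le> k * k \<Longrightarrow> Junc_out g \<in> N (Junc_in g)"
    and connected: "W \<subset> verts k p \<Longrightarrow> W \<noteq> {} \<Longrightarrow> \<exists>u\<in>W. \<not> N u \<subseteq> W"
begin

lemma N_iff: "u \<in> verts k p \<Longrightarrow> v \<in> verts k p \<Longrightarrow> v \<in> N u \<longleftrightarrow> u \<in> N v"
  using N_sym by blast

lemma rung_converse: "i < k \<Longrightarrow> l < k \<Longrightarrow> Enter i l \<in> N (Exit l i)"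
  by (rule N_sym[OF _ _ rung]) auto

lemma junction_converse: "g \<le> k * k \<Longrightarrow> Junc_in g \<in> N (Junc_out g)"
  by (rule N_sym[OF _ _ junction]) auto

text \<open>Besides the junction edges, \<open>Junc_out g\<close> and \<open>Junc_in (Suc g)\<close>
  have one more neighbour each. Either they are joined to each other, or both use their only other
  allowed neighbour, \<open>Enter i l\<close> and \<open>Exit i l\<close>.\<close>

lemma escape_both_ends:
  assumes "i \<le> l" "l < k"
  shows "Junc_out (i * k + l) \<in> N (Enter i l) \<longleftrightarrow> Junc_in (Suc (i * k + l)) \<in> N (Exit i l)"
proof -
  define g where "g = i * k + l"
  have g: "g div k = i" "g mod k = l" "g < k * k" using assms pair_index[of i k l] by (auto simp: g_def)
  have "Junc_in g \<in> N (Junc_out g)" using junction_converse g by simp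
  then obtain q where q: "q \<noteq> Junc_in g" "N (Junc_out g) = {Junc_in g, q}"
    using other_neighbour[of "Junc_out g" "Junc_in g"] g by auto
  have "Junc_out (Suc g) \<in> N (Junc_in (Suc g))" using junction g by simp
  then obtain r where r: "r \<noteq> Junc_out (Suc g)" "N (Junc_in (Suc g)) = {Junc_out (Suc g), r}"
    using other_neighbour[of "Junc_in (Suc g)" "Junc_out (Suc g)"] g by auto
  have "q \<in> {Junc_in (Suc g), Enter i l}" using N_allowed[of "Junc_out g"] g q by auto
  moreover have "r \<in> {Junc_out g, Exit i l}" using N_allowed[of "Junc_in (Suc g)"] g r by auto
  moreover have "Junc_in (Suc g) \<in> N (Junc_out g) \<longleftrightarrow> Junc_out g \<in> N (Junc_in (Suc g))"
    using g by (intro N_iff) auto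
  moreover have "Enter i l \<in> N (Junc_out g) \<longleftrightarrow> Junc_out g \<in> N (Enter i l)"
    using g assms by (intro N_iff) auto
  moreover have "Exit i l \<in> N (Junc_in (Suc g)) \<longleftrightarrow> Junc_in (Suc g) \<in> N (Exit i l)"
    using g assms by (intro N_iff) auto
  ultimately show ?thesis unfolding g_def[symmetric] using q r by auto
qed

text \<open>Besides the rungs, \<open>Enter i l\<close> and \<open>Exit i l\<close> have one more
  neighbour each. The inner edge and the detour through the backbone are used at both or at neither,
  hence so is the remaining option, the row edge.\<close>

lemma row_step:
  assumes "i < k" "Suc l < k"
  shows "left i l \<in> N (Enter i l) \<longleftrightarrow> left i (Suc l) \<in> N (Enter i (Suc l))"
proof -
  obtain q where q: "q \<noteq> Exit l i" "N (Enter i l) = {Exit l i, q}"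
    using other_neighbour[of "Enter i l" "Exit l i"] rung assms by auto
  have "Enter l i \<in> N (Exit i l)" using rung_converse assms by simp
  then obtain r where r: "r \<noteq> Enter l i" "N (Exit i l) = {Enter l i, r}"
    using other_neighbour[of "Exit i l" "Enter l i"] assms by auto
  have left: "left i l \<noteq> Exit i l" "left i l \<noteq> Exit l i" "left i l \<noteq> Junc_out g" for g
    by (cases l; auto)+
  have q': "q = Exit i l \<or> q = left i l \<or> i \<le> l \<and> q = Junc_out (i * k + l)"
    using N_allowed[of "Enter i l"] q assms by (auto split: if_splits)
  have r': "r = Enter i l \<or> r = Enter i (Suc l) \<or> i \<le> l \<and> r = Junc_in (Suc (i * k + l))"
    using N_allowed[of "Exit i l"] r assms by (auto split: if_splits)
  have "Exit i l \<in> N (Enter i l) \<longleftrightarrow> Enter i l \<in> N (Exit i l)"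
    using assms by (intro N_iff) auto
  \<comment> \<open>On the diagonal the inner edge is the rung, which \<open>q\<close> and
    \<open>r\<close> exclude.\<close>
  then have inner: "i = l \<or> (q = Exit i l \<longleftrightarrow> r = Enter i l)"
    unfolding q r by auto
  have escape: "q = Junc_out (i * k + l) \<longleftrightarrow> r = Junc_in (Suc (i * k + l))" if "i \<le> l"
    using escape_both_ends[of i l] that assms unfolding q r by auto
  have "q = left i l \<longleftrightarrow> r = Enter i (Suc l)"
    using q(1) r(1) q' r' inner escape left by (metis vertex.distinct vertex.inject(1) n_not_Suc_n)
  then have "left i l \<in> N (Enter i l) \<longleftrightarrow> Enter i (Suc l) \<in> N (Exit i l)"
    unfolding q r using left by auto
  also have "\<dots> \<longleftrightarrow> Exit i l \<in> N (Enter i (Suc l))"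
    using assms by (intro N_iff) auto
  finally show ?thesis by simp
qed

text \<open>Hence a row encodes a single truth value, legible at its first edge.\<close>

lemma row_constant:
  assumes "i < k" "l < k"
  shows "left i l \<in> N (Enter i l) \<longleftrightarrow> Start i \<in> N (Enter i 0)"
  using assms(2)
proof (induction l)
  case (Suc l)
  then show ?case using row_step[of i l] assms(1) by simp
qed simp

text \<open>Without the detour both \<open>Enter\<close> vertices have only the two
  \<open>Exit\<close> vertices as neighbours, so the crossing would be a separate 4-cycle.\<close>

lemma both_rows_off:
  assumes "i < j" "j < k" "Start i \<notin> N (Enter i 0)" "Start j \<notin> N (Enter j 0)"
  shows "Junc_out (i * k + j) \<in> N (Enter i j)"
proof (rule ccontr)
  assume no_escape: "\<not> ?thesis"
  have "left i j \<notin> N (Enter i j)" "left j i \<notin> N (Enter j i)"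
    using row_constant assms by simp_all
  then have sub: "N (Enter i j) \<subseteq> {Exit j i, Exit i j}" "N (Enter j i) \<subseteq> {Exit j i, Exit i j}"
    using no_escape N_allowed[of "Enter i j"] N_allowed[of "Enter j i"] assms by auto
  have enter: "N (Enter i j) = {Exit j i, Exit i j}" "N (Enter j i) = {Exit j i, Exit i j}"
    using N_eq_supset[OF _ sub(1)] N_eq_supset[OF _ sub(2)] assms by simp_all
  have in_V: "Enter i j \<in> verts k p" "Enter j i \<in> verts k p" "Exit i j \<in> verts k p" "Exit j i \<in> verts k p"
    using assms by simp_all
  have mem: "Enter i j \<in> N (Exit i j)" "Enter j i \<in> N (Exit i j)"
    "Enter i j \<in> N (Exit j i)" "Enter j i \<in> N (Exit j i)"
    using N_sym[OF in_V(1,3)] N_sym[OF in_V(2,3)] N_sym[OF in_V(1,4)] N_sym[OF in_V(2,4)]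
    unfolding enter by simp_all
  have exit: "N (Exit i j) = {Enter i j, Enter j i}" "N (Exit j i) = {Enter i j, Enter j i}"
    using N_eqI[OF in_V(3) mem(1,2)] N_eqI[OF in_V(4) mem(3,4)] \<open>i < j\<close> by simp_all
  let ?W = "{Enter i j, Enter j i, Exit i j, Exit j i}"
  have "?W \<subseteq> verts k p" using in_V by blast
  \<comment> \<open>\<open>Junc_in 0\<close> witnesses that the 4-cycle misses a vertex.\<close>
  moreover have "Junc_in 0 \<in> verts k p" "Junc_in 0 \<notin> ?W" by simp_all
  ultimately have "?W \<subset> verts k p" by blast
  then have "\<exists>u\<in>?W. \<not> N u \<subseteq> ?W" by (rule connected) simp
  then show False using enter exit by auto
qed

end

text \<open>Where \<open>followed\<close> is not \<open>UNIV\<close> it has at most two elements, so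
  the inclusion already determines \<open>N u\<close>.\<close>

locale followed_tour = two_factor +
  fixes b :: "nat set"
  assumes N_followed: "u \<in> verts k p \<Longrightarrow> N u \<subseteq> followed k b u"
begin

lemma N_Enter:
  assumes "i < k" "l < k"
  shows "N (Enter i l) = {Exit l i,
     if i \<in> b then if i \<le> l \<and> l \<in> b then Junc_out (i * k + l) else Exit i l else left i l}"
  using N_followed[of "Enter i l"] assms by (intro N_eq_supset) auto

lemma start_iff: "i < k \<Longrightarrow> Start i \<in> N (Enter i 0) \<longleftrightarrow> i \<notin> b"
  by (subst N_Enter) auto

lemma escape_iff:
  assumes "i < j" "j < k"
  shows "Junc_out (i * k + j) \<in> N (Enter i j) \<longleftrightarrow> i \<in> b \<and> j \<in> b"
proof -
  have "Junc_out g \<noteq> left i j" for g by (cases j) auto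
  then show ?thesis using assms by (subst N_Enter) auto
qed

lemma junction:
  assumes "g \<le> k * k" "k > 0"
  shows "Junc_out g \<in> N (Junc_in g)"
proof (cases g)
  case 0
  \<comment> \<open>\<open>Junc_in 0\<close> is a free end, so this edge is obtained from
    \<open>Junc_out 0\<close>, which is constrained since \<open>k > 0\<close>.\<close>
  then have "Junc_in 0 \<in> N (Junc_out 0)" using assms
    using N_followed[of "Junc_out 0"] N_eq_supset[of "Junc_out 0" "Junc_in 0"] by auto
  then show ?thesis using N_sym[of "Junc_out 0" "Junc_in 0"] 0 by auto
next
  case (Suc h)
  then show ?thesis
    using assms N_followed[of "Junc_in (Suc h)"] N_eq_supset[of "Junc_in (Suc h)" "Junc_out (Suc h)"] by auto
qed

lemma rung: "i < k \<Longrightarrow> l < k \<Longrightarrow> Exit l i \<in> N (Enter i l)"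
  by (simp add: N_Enter)

end

subsection \<open>Construction of tours\<close>

definition related :: "nat \<Rightarrow> nat set \<Rightarrow> vertex \<Rightarrow> vertex \<Rightarrow> bool" where
  "related k b u v \<longleftrightarrow> v \<in> followed k b u \<and> u \<in> followed k b v"

lemma related_sym: "related k b u v \<Longrightarrow> related k b v u"
  by (simp add: related_def)

lemma related_left: "i \<notin> b \<Longrightarrow> l < k \<Longrightarrow> related k b (left i l) (Enter i l)"
  by (cases l) (auto simp: related_def)

text \<open>
  Crossings are processed in the order of the following index, which increases along every row.
  If both variables are 0 the two paths swap rows, but both proceed to the right,
  and so no cycle arises.
\<close>

definition gadget_index :: "nat \<Rightarrow> nat \<Rightarrow> nat \<Rightarrow> nat" where
  "gadget_index k i l = min i l * k + max i l"

text \<open>In base \<open>k\<close> the leading digit \<open>min i l\<close> never drops along a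
  row, and once it is constant the last digit grows.\<close>

lemma gadget_index_less:
  assumes "i < k" "l < m" "m < k"
  shows "gadget_index k i l < gadget_index k i m"
proof -
  have *: "x * k + y < z * k" if "x < z" "y < k" for x y z
  proof -
    have "x * k + y < Suc x * k" using that by simp
    also have "\<dots> \<le> z * k" using that by (intro mult_right_mono) auto
    finally show ?thesis .
  qed
  consider "i \<le> l" | "l < i" "i \<le> m" | "m < i" by linarith
  then show ?thesis
  proof cases
    case 2
    then show ?thesis using *[of l i i] assms by (simp add: gadget_index_def min_def max_def)
  next
    case 3
    then show ?thesis using *[of l m i] assms by (simp add: gadget_index_def min_def max_def)
  qed (use assms in \<open>simp add: gadget_index_def min_def max_def\<close>)
qed

lemma gadget_index_bound: "i < k \<Longrightarrow> l < k \<Longrightarrow> gadget_index k i l < k * k"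
  by (simp add: gadget_index_def pair_index(3))

lemma gadget_index_eqD:
  assumes "i < k" "l < k" "gadget_index k i l = g"
  shows "g div k \<le> g mod k" "i = g div k \<and> l = g mod k \<or> i = g mod k \<and> l = g div k"
  using assms pair_index[of "min i l" k "max i l"] by (auto simp: gadget_index_def min_def max_def)

text \<open>Tells where row \<open>i\<close> resumes once the crossings with index below
  \<open>g\<close> are done; \<open>l = k\<close> means that the row is finished.\<close>

definition next_column :: "nat \<Rightarrow> nat \<Rightarrow> nat \<Rightarrow> nat \<Rightarrow> bool" where
  "next_column k g i l \<longleftrightarrow> l \<le> k \<and> (\<forall>m<k. gadget_index k i m < g \<longleftrightarrow> m < l)"

lemma next_column_gadget_index:
  assumes "i < k" "l < k"
  shows "next_column k (gadget_index k i l) i l"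
  unfolding next_column_def
  using gadget_index_less[of i k] assms by (metis less_imp_le linorder_neqE_nat order_less_asym order_less_irrefl)

lemma next_column_Suc_gadget_index:
  assumes "next_column k (Suc (gadget_index k i m)) i l" "i < k" "m < k"
  shows "l = Suc m"
proof -
  have "m < l" using assms by (auto simp: next_column_def)
  moreover have "\<not> Suc m < l"
  proof
    assume "Suc m < l"
    then have "gadget_index k i (Suc m) < Suc (gadget_index k i m)" "Suc m < k"
      using assms(1) by (auto simp: next_column_def)
    then show False using gadget_index_less[of i k m "Suc m"] assms by simp
  qed
  ultimately show ?thesis by simp
qed

lemma next_column_Suc_other:
  assumes "next_column k (Suc g) i l" "\<And>m. m < k \<Longrightarrow> gadget_index k i m \<noteq> g"
  shows "next_column k g i l"
  using assms unfolding next_column_def by (metis less_Suc_eq)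

lemma next_column_0: "next_column k 0 i l \<Longrightarrow> l = 0"
  by (auto simp: next_column_def)

lemma next_column_end: "i < k \<Longrightarrow> next_column k (k * k) i k"
  by (auto simp: next_column_def gadget_index_bound)

text \<open>\<open>i\<close> is the row in which the path ends at stage \<open>g\<close>. It may
  have begun in another row, because crossings can swap paths, so its head is only known to be some
  \<open>Start\<close>. A row with value 1 is bypassed and keeps just
  \<open>Start i\<close>.\<close>

definition row_path :: "nat \<Rightarrow> nat set \<Rightarrow> nat \<Rightarrow> nat \<Rightarrow> vertex list \<Rightarrow> bool" where
  "row_path k b g i xs \<longleftrightarrow> successively (related k b) xs \<and> xs \<noteq> [] \<and> hd xs \<in> range Start \<and>
     (if i \<in> b then xs = [Start i] else \<forall>l. next_column k g i l \<longrightarrow> last xs = left i l)"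

lemma row_path_other:
  assumes "row_path k b g i xs" "i \<in> b \<or> (\<forall>m<k. gadget_index k i m \<noteq> g)"
  shows "row_path k b (Suc g) i xs"
  using assms next_column_Suc_other unfolding row_path_def by (metis (full_types))

text \<open>Carries the path of row \<open>j\<close> through crossing \<open>g\<close>; it comes out
  in row \<open>i\<close>, a different row when paths swap.\<close>

lemma row_path_extend:
  assumes "row_path k b g j xs" "j \<notin> b" "j < k" "m < k" "gadget_index k j m = g"
    and "i \<notin> b" "i < k" "l < k" "gadget_index k i l = g"
    and "successively (related k b) ys" "ys \<noteq> []" "hd ys = Enter j m" "last ys = Exit i l"
  shows "row_path k b (Suc g) i (xs @ ys)"
proof -
  have "next_column k g j m" using next_column_gadget_index[of j k m] assms(3-5) by simp
  then have xs: "successively (related k b) xs" "xs \<noteq> []" "hd xs \<in> range Start" "last xs = left j m"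
    using assms(1,2) by (auto simp: row_path_def)
  moreover have "related k b (left j m) (Enter j m)" using related_left assms(2,4) .
  moreover have "last (xs @ ys) = left i c" if "next_column k (Suc g) i c" for c
  proof -
    have "c = Suc l" using next_column_Suc_gadget_index[of k i l c] that assms(7-9) by simp
    then show ?thesis using assms(11,13) by simp
  qed
  ultimately show ?thesis using assms(6,10-12)
    by (simp add: row_path_def successively_append_iff)
qed

definition ends :: "nat \<Rightarrow> nat \<Rightarrow> vertex multiset" where
  "ends i l = {#Enter i l, Exit i l#}"

text \<open>Every crossing is charged to the pair with the smaller row first, and a diagonal one is
  counted once.\<close>

definition gadget_verts :: "nat \<Rightarrow> nat \<Rightarrow> vertex multiset" where
  "gadget_verts i l = (if i \<le> l then ends i l else {#}) + (if i < l then ends l i else {#})"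

text \<open>The state after the crossings below \<open>g\<close>. The multiset equation says that
  the vertices met so far are used exactly once each; it makes distinctness a matter of
  counting.\<close>

definition partial_tour :: "nat \<Rightarrow> nat set \<Rightarrow> nat \<Rightarrow> (nat \<Rightarrow> vertex list) \<Rightarrow> vertex list \<Rightarrow> bool" where
  "partial_tour k b g R B \<longleftrightarrow>
     (\<forall>i<k. row_path k b g i (R i)) \<and>
     successively (related k b) B \<and> B \<noteq> [] \<and> hd B = Junc_in 0 \<and> last B = Junc_out g \<and>
     (\<Sum>i<k. mset (R i)) + mset B = (\<Sum>i<k. {#Start i#}) + (\<Sum>h\<le>g. {#Junc_in h, Junc_out h#}) +
       (\<Sum>h<g. gadget_verts (h div k) (h mod k))"

lemma partial_tour_0:
  assumes "k > 0"
  shows "partial_tour k b 0 (\<lambda>i. [Start i]) [Junc_in 0, Junc_out 0]"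
  using assms by (auto simp: partial_tour_def row_path_def related_def dest!: next_column_0)

text \<open>\<open>xs\<close> is the detour of the backbone through crossing \<open>g\<close>, empty
  if none is made.\<close>

lemma partial_tour_Suc:
  assumes "partial_tour k b g R B"
    and "\<And>i. i < k \<Longrightarrow> row_path k b (Suc g) i (R' i)"
    and "successively (related k b) (xs @ [Junc_in (Suc g), Junc_out (Suc g)])"
    and "related k b (Junc_out g) (hd (xs @ [Junc_in (Suc g)]))"
    and "(\<Sum>i<k. mset (R' i)) + mset xs = (\<Sum>i<k. mset (R i)) + gadget_verts (g div k) (g mod k)"
  shows "partial_tour k b (Suc g) R' (B @ xs @ [Junc_in (Suc g), Junc_out (Suc g)])"
proof -
  have "(\<Sum>i<k. mset (R' i)) + mset (B @ xs @ [Junc_in (Suc g), Junc_out (Suc g)]) =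
      ((\<Sum>i<k. mset (R' i)) + mset xs) + mset B + {#Junc_in (Suc g), Junc_out (Suc g)#}"
    by simp
  also have "\<dots> = ((\<Sum>i<k. mset (R i)) + mset B) + gadget_verts (g div k) (g mod k) +
      {#Junc_in (Suc g), Junc_out (Suc g)#}"
    unfolding assms(5) by (simp only: ac_simps)
  also have "(\<Sum>i<k. mset (R i)) + mset B = (\<Sum>i<k. {#Start i#}) +
      (\<Sum>h\<le>g. {#Junc_in h, Junc_out h#}) + (\<Sum>h<g. gadget_verts (h div k) (h mod k))"
    using assms(1) by (simp add: partial_tour_def)
  also have "\<dots> + gadget_verts (g div k) (g mod k) + {#Junc_in (Suc g), Junc_out (Suc g)#} =
      (\<Sum>i<k. {#Start i#}) + (\<Sum>h\<le>Suc g. {#Junc_in h, Junc_out h#}) +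
      (\<Sum>h<Suc g. gadget_verts (h div k) (h mod k))"
    by (simp only: sum.atMost_Suc sum.lessThan_Suc ac_simps)
  finally have "(\<Sum>i<k. mset (R' i)) + mset (B @ xs @ [Junc_in (Suc g), Junc_out (Suc g)]) = \<dots>" .
  moreover have "hd (xs @ [Junc_in (Suc g)]) = hd (xs @ [Junc_in (Suc g), Junc_out (Suc g)])"
    by (cases xs) auto
  ultimately show ?thesis
    using assms(1-4) by (simp add: partial_tour_def successively_append_iff)
qed

lemma sum_mset_fun_upd:
  assumes "a < (k::nat)"
  shows "(\<Sum>i<k. mset ((R(a := xs)) i)) + mset (R a) = (\<Sum>i<k. mset (R i)) + mset xs"
proof -
  have "(\<Sum>i<k. mset ((R(a := xs)) i)) = mset xs + (\<Sum>i\<in>{..<k} - {a}. mset (R i))"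
    using assms by (subst sum.remove[of _ a]) auto
  moreover have "(\<Sum>i<k. mset (R i)) = mset (R a) + (\<Sum>i\<in>{..<k} - {a}. mset (R i))"
    using assms by (subst sum.remove[of _ a]) auto
  ultimately show ?thesis by (simp add: ac_simps)
qed

text \<open>At most the two rows that meet at crossing \<open>g\<close> are affected; how it is
  traversed depends on their values.\<close>

lemma partial_tour_step:
  assumes PT: "partial_tour k b g R B" and "g < k * k"
  shows "\<exists>R' B'. partial_tour k b (Suc g) R' B'"
proof -
  have "k > 0" using assms(2) by (cases k) auto
  define i l where "i = g div k" and "l = g mod k"
  have il: "i < k" "l < k" "i * k + l = g"
    using assms(2) \<open>k > 0\<close> by (auto simp: i_def l_def less_mult_imp_div_less)
  have rows: "row_path k b g j (R j)" if "j < k" for j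
    using PT that by (simp add: partial_tour_def)
  have other: "row_path k b (Suc g) j (R j)" if "j < k" "j \<in> b \<or> j \<noteq> i \<and> j \<noteq> l \<or> l < i" for j
  proof (rule row_path_other[OF rows])
    show "j \<in> b \<or> (\<forall>m<k. gadget_index k j m \<noteq> g)"
      using that(2) gadget_index_eqD[OF \<open>j < k\<close>, of _ g] unfolding i_def l_def by (metis leD)
  qed fact
  have junc: "related k b (Junc_out g) (Junc_in (Suc g))" if "\<not> (i \<le> l \<and> i \<in> b \<and> l \<in> b)"
    using that assms(2) by (auto simp: related_def i_def l_def)
  have junc': "related k b (Junc_in (Suc g)) (Junc_out (Suc g))"
    using assms(2) by (auto simp: related_def)
  have gi: "gadget_index k i l = g" "gadget_index k l i = g" if "i \<le> l"
    using that il by (simp_all add: gadget_index_def min_def max_def)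
  note step = partial_tour_Suc[OF PT]
  consider "l < i" | "i = l" "i \<in> b" | "i = l" "i \<notin> b" | "i < l" "i \<in> b" "l \<in> b"
    | "i < l" "i \<in> b" "l \<notin> b" | "i < l" "i \<notin> b" "l \<in> b" | "i < l" "i \<notin> b" "l \<notin> b"
    by linarith
  then show ?thesis
  proof cases
    \<comment> \<open>This index belongs to no crossing, so only the backbone grows.\<close>
    case 1
    have "partial_tour k b (Suc g) R (B @ [] @ [Junc_in (Suc g), Junc_out (Suc g)])"
      by (rule step) (use 1 other junc junc' in \<open>auto simp: gadget_verts_def simp flip: i_def l_def\<close>)
    then show ?thesis by blast
  next
    \<comment> \<open>The backbone collects the diagonal vertices of a bypassed row.\<close>
    case 2
    have "partial_tour k b (Suc g) R (B @ [Enter i i, Exit i i] @ [Junc_in (Suc g), Junc_out (Suc g)])"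
    proof (rule step)
      show "row_path k b (Suc g) j (R j)" if "j < k" for j using that other 2 by blast
      show "successively (related k b) ([Enter i i, Exit i i] @ [Junc_in (Suc g), Junc_out (Suc g)])"
        using 2 il assms(2) junc' by (auto simp: related_def simp flip: i_def l_def)
      show "related k b (Junc_out g) (hd ([Enter i i, Exit i i] @ [Junc_in (Suc g)]))"
        using 2 il assms(2) by (auto simp: related_def simp flip: i_def l_def)
      show "(\<Sum>i<k. mset (R i)) + mset [Enter i i, Exit i i] =
          (\<Sum>i<k. mset (R i)) + gadget_verts (g div k) (g mod k)"
        using 2 by (simp add: gadget_verts_def ends_def flip: i_def l_def)
    qed
    then show ?thesis by blast
  next
    case 3
    let ?ys = "[Enter i i, Exit i i]"
    have "partial_tour k b (Suc g) (R(i := R i @ ?ys)) (B @ [] @ [Junc_in (Suc g), Junc_out (Suc g)])"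
    proof (rule step)
      have "row_path k b (Suc g) i (R i @ ?ys)"
        by (rule row_path_extend[where j = i and m = i and l = i and g = g])
          (use 3 il gi rows in \<open>auto simp: related_def\<close>)
      then show "row_path k b (Suc g) j ((R(i := R i @ ?ys)) j)" if "j < k" for j
        using that other[of j] 3 by auto
      show "(\<Sum>j<k. mset ((R(i := R i @ ?ys)) j)) + mset [] =
          (\<Sum>j<k. mset (R j)) + gadget_verts (g div k) (g mod k)"
        using sum_mset_fun_upd[of i k R "R i @ ?ys"] 3 il
        by (simp add: gadget_verts_def ends_def flip: i_def l_def)
    qed (use junc junc' 3 in auto)
    then show ?thesis by blast
  next
    \<comment> \<open>The backbone takes the 4-cycle, cut open at the edge between
      \<open>Exit i l\<close> and \<open>Enter i l\<close>.\<close>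
    case 4
    let ?xs = "[Enter i l, Exit l i, Enter l i, Exit i l]"
    have "partial_tour k b (Suc g) R (B @ ?xs @ [Junc_in (Suc g), Junc_out (Suc g)])"
    proof (rule step)
      show "row_path k b (Suc g) j (R j)" if "j < k" for j using that other 4 by blast
      show "successively (related k b) (?xs @ [Junc_in (Suc g), Junc_out (Suc g)])"
        using 4 il assms(2) junc' by (auto simp: related_def simp flip: i_def l_def)
      show "related k b (Junc_out g) (hd (?xs @ [Junc_in (Suc g)]))"
        using 4 il assms(2) by (auto simp: related_def simp flip: i_def l_def)
      show "(\<Sum>i<k. mset (R i)) + mset ?xs = (\<Sum>i<k. mset (R i)) + gadget_verts (g div k) (g mod k)"
        using 4 by (simp add: gadget_verts_def ends_def flip: i_def l_def)
    qed
    then show ?thesis by blast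
  next
    \<comment> \<open>Row \<open>l\<close> passes and picks up the two vertices of the bypassed row
      \<open>i\<close> on the way.\<close>
    case 5
    let ?ys = "[Enter l i, Exit i l, Enter i l, Exit l i]"
    have "partial_tour k b (Suc g) (R(l := R l @ ?ys)) (B @ [] @ [Junc_in (Suc g), Junc_out (Suc g)])"
    proof (rule step)
      have "row_path k b (Suc g) l (R l @ ?ys)"
        by (rule row_path_extend[where j = l and m = i and l = i and g = g])
          (use 5 il gi rows in \<open>auto simp: related_def\<close>)
      then show "row_path k b (Suc g) j ((R(l := R l @ ?ys)) j)" if "j < k" for j
        using that other[of j] 5 by auto
      show "(\<Sum>j<k. mset ((R(l := R l @ ?ys)) j)) + mset [] =
          (\<Sum>j<k. mset (R j)) + gadget_verts (g div k) (g mod k)"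
        using sum_mset_fun_upd[of l k R "R l @ ?ys"] 5 il
        by (simp add: gadget_verts_def ends_def flip: i_def l_def)
    qed (use junc junc' 5 in auto)
    then show ?thesis by blast
  next
    case 6
    let ?ys = "[Enter i l, Exit l i, Enter l i, Exit i l]"
    have "partial_tour k b (Suc g) (R(i := R i @ ?ys)) (B @ [] @ [Junc_in (Suc g), Junc_out (Suc g)])"
    proof (rule step)
      have "row_path k b (Suc g) i (R i @ ?ys)"
        by (rule row_path_extend[where j = i and m = l and l = l and g = g])
          (use 6 il gi rows in \<open>auto simp: related_def\<close>)
      then show "row_path k b (Suc g) j ((R(i := R i @ ?ys)) j)" if "j < k" for j
        using that other[of j] 6 by auto
      show "(\<Sum>j<k. mset ((R(i := R i @ ?ys)) j)) + mset [] =
          (\<Sum>j<k. mset (R j)) + gadget_verts (g div k) (g mod k)"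
        using sum_mset_fun_upd[of i k R "R i @ ?ys"] 6 il
        by (simp add: gadget_verts_def ends_def flip: i_def l_def)
    qed (use junc junc' 6 in auto)
    then show ?thesis by blast
  next
    case 7
    let ?ys = "[Enter l i, Exit i l]" and ?zs = "[Enter i l, Exit l i]"
    let ?R = "R(i := R l @ ?ys, l := R i @ ?zs)"
    have "partial_tour k b (Suc g) ?R (B @ [] @ [Junc_in (Suc g), Junc_out (Suc g)])"
    proof (rule step)
      have "row_path k b (Suc g) i (R l @ ?ys)"
        by (rule row_path_extend[where j = l and m = i and l = l and g = g])
          (use 7 il gi rows in \<open>auto simp: related_def\<close>)
      moreover have "row_path k b (Suc g) l (R i @ ?zs)"
        by (rule row_path_extend[where j = i and m = l and l = i and g = g])
          (use 7 il gi rows in \<open>auto simp: related_def\<close>)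
      ultimately show "row_path k b (Suc g) j (?R j)" if "j < k" for j
        using that other[of j] 7 by auto
      have "(\<Sum>j<k. mset (?R j)) + mset (R l) = (\<Sum>j<k. mset ((R(i := R l @ ?ys)) j)) + mset (R i @ ?zs)"
        using sum_mset_fun_upd[of l k "R(i := R l @ ?ys)" "R i @ ?zs"] 7 il by simp
      then have "(\<Sum>j<k. mset (?R j)) + mset (R l) + mset (R i) =
          ((\<Sum>j<k. mset ((R(i := R l @ ?ys)) j)) + mset (R i)) + mset (R i @ ?zs)"
        by (simp add: ac_simps)
      also have "\<dots> = (\<Sum>j<k. mset (R j)) + mset (R l @ ?ys) + mset (R i @ ?zs)"
        using sum_mset_fun_upd[of i k R "R l @ ?ys"] il by simp
      finally have "(\<Sum>j<k. mset (?R j)) = (\<Sum>j<k. mset (R j)) + mset ?ys + mset ?zs"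
        by simp
      then show "(\<Sum>j<k. mset (?R j)) + mset [] = (\<Sum>j<k. mset (R j)) + gadget_verts (g div k) (g mod k)"
        using 7 by (simp add: gadget_verts_def ends_def flip: i_def l_def)
    qed (use junc junc' 7 in auto)
    then show ?thesis by blast
  qed
qed

lemma partial_tour_exists:
  assumes "k > 0" "g \<le> k * k"
  shows "\<exists>R B. partial_tour k b g R B"
  using assms(2)
proof (induction g)
  case 0
  then show ?case using partial_tour_0[OF assms(1)] by blast
next
  case (Suc g)
  then show ?case using partial_tour_step by (metis Suc_le_eq less_imp_le)
qed

section \<open>Joining the pieces to one cycle\<close>

lemma sum_pair_index: "(\<Sum>h<k * k. f (h div k) (h mod k)) = (\<Sum>i<k. \<Sum>l<k. f i l)"
  for f :: "nat \<Rightarrow> nat \<Rightarrow> 'c::comm_monoid_add"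
proof -
  have "bij_betw (\<lambda>(i, l). i * k + l) ({..<k} \<times> {..<k}) {..<k * k}"
  proof (rule bij_betw_byWitness[where f' = "\<lambda>h. (h div k, h mod k)"])
    show "(\<lambda>h. (h div k, h mod k)) ` {..<k * k} \<subseteq> {..<k} \<times> {..<k}"
      by (auto simp: less_mult_imp_div_less intro!: mod_less_divisor) (metis gr0I less_nat_zero_code mult_0)
  qed (auto simp: pair_index)
  then have "(\<Sum>h<k * k. f (h div k) (h mod k)) =
      (\<Sum>(i, l)\<in>{..<k} \<times> {..<k}. f ((i * k + l) div k) ((i * k + l) mod k))"
    by (simp add: sum.reindex_bij_betw[symmetric] split_def)
  also have "\<dots> = (\<Sum>(i, l)\<in>{..<k} \<times> {..<k}. f i l)"
    by (rule sum.cong) (auto simp: pair_index)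
  finally show ?thesis by (simp add: sum.cartesian_product)
qed

text \<open>Exchanging the summation indices moves the part of each crossing that lies in its larger
  row to the pairs below the diagonal.\<close>

lemma sum_gadget_verts:
  "(\<Sum>h<k * k. gadget_verts (h div k) (h mod k)) = (\<Sum>i<k. \<Sum>l<k. ends i l)"
proof -
  have "(\<Sum>i<k. \<Sum>l<k. if i < l then ends l i else {#}) = (\<Sum>i<k. \<Sum>l<k. if l < i then ends i l else {#})"
    by (rule sum.swap)
  then have "(\<Sum>i<k. \<Sum>l<k. gadget_verts i l) =
      (\<Sum>i<k. \<Sum>l<k. (if i \<le> l then ends i l else {#}) + (if l < i then ends i l else {#}))"
    by (simp add: gadget_verts_def sum.distrib)
  also have "\<dots> = (\<Sum>i<k. \<Sum>l<k. ends i l)"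
    by (intro sum.cong) auto
  finally show ?thesis by (simp add: sum_pair_index)
qed

lemma successively_concat:
  assumes "xss \<noteq> []"
    and "\<And>xs. xs \<in> set xss \<Longrightarrow> xs \<noteq> [] \<and> successively r xs \<and> hd xs \<in> U \<and> last xs \<in> U"
    and "\<And>u v. u \<in> U \<Longrightarrow> v \<in> U \<Longrightarrow> r u v"
  shows "concat xss \<noteq> [] \<and> successively r (concat xss) \<and> hd (concat xss) \<in> U \<and> last (concat xss) \<in> U"
  using assms(1,2)
proof (induction xss rule: list_nonempty_induct)
  case (cons xs xss)
  then show ?case using assms(3) by (auto simp: successively_append_iff)
qed auto

text \<open>Row paths, backbone and padding all begin and end at unconstrained vertices, so they can
  be linked in any order and closed up.\<close>

lemma followed_cycle_exists:
  assumes "k > 0"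
  obtains L where "distinct L" "set L = verts k p" "successively (related k b) L"
    "related k b (last L) (hd L)"
proof -
  obtain R B where PT: "partial_tour k b (k * k) R B" using partial_tour_exists[OF assms] by blast
  define xss where "xss = map R [0..<k] @ [B] @ map (\<lambda>r. [Pad r]) [0..<p]"
  define U where "U = {u. followed k b u = UNIV}"
  have rows: "R i \<noteq> [] \<and> successively (related k b) (R i) \<and> hd (R i) \<in> U \<and> last (R i) \<in> U" if "i < k" for i
  proof -
    have row: "row_path k b (k * k) i (R i)" using PT that by (simp add: partial_tour_def)
    have "last (R i) = (if i \<in> b then Start i else Exit i (k - 1))"
      using row next_column_end[OF that] assms by (cases k) (auto simp: row_path_def)
    then have "last (R i) \<in> U" using assms by (auto simp: U_def)
    then show ?thesis using row by (auto simp: row_path_def U_def)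
  qed
  have "concat xss \<noteq> [] \<and> successively (related k b) (concat xss) \<and>
      hd (concat xss) \<in> U \<and> last (concat xss) \<in> U"
  proof (rule successively_concat)
    show "related k b u v" if "u \<in> U" "v \<in> U" for u v using that by (auto simp: U_def related_def)
    show "xs \<noteq> [] \<and> successively (related k b) xs \<and> hd xs \<in> U \<and> last xs \<in> U" if "xs \<in> set xss" for xs
    proof -
      have "B \<noteq> [] \<and> successively (related k b) B \<and> hd B \<in> U \<and> last B \<in> U"
        using PT by (auto simp: partial_tour_def U_def)
      then show ?thesis using that rows by (auto simp: xss_def) (auto simp: U_def)
    qed
  qed (simp add: xss_def)
  moreover have "related k b u v" if "u \<in> U" "v \<in> U" for u v using that by (auto simp: U_def related_def)
  moreover have mset: "mset (concat xss) = (\<Sum>i<k. {#Start i#}) + (\<Sum>h\<le>k * k. {#Junc_in h, Junc_out h#}) +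
      (\<Sum>i<k. \<Sum>l<k. ends i l) + mset (map Pad [0..<p])"
  proof -
    have "mset (concat xss) = (\<Sum>i<k. mset (R i)) + mset B + mset (map Pad [0..<p])"
      by (simp add: xss_def mset_concat o_def interv_sum_list_conv_sum_set_nat atLeast0LessThan)
    then show ?thesis using PT by (simp add: partial_tour_def sum_gadget_verts)
  qed
  moreover have set: "set (concat xss) = verts k p"
  proof -
    have "set (concat xss) = set_mset (mset (concat xss))" by (rule set_mset_mset[symmetric])
    also have "\<dots> = verts k p" unfolding mset
      by (auto simp: verts_def set_mset_sum ends_def image_iff)
    finally show ?thesis .
  qed
  \<comment> \<open>The multiset equation gives the length, which equals the number of
    vertices.\<close>
  moreover have "distinct (concat xss)"
  proof (rule card_distinct)
    have "length (concat xss) = size (mset (concat xss))" by (rule size_mset[symmetric])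
    also have "\<dots> = card (verts k p)" unfolding mset
      by (simp add: card_verts size_multiset_sum ends_def power2_eq_square)
    finally show "card (set (concat xss)) = length (concat xss)" unfolding set by (rule sym)
  qed
  ultimately show thesis using that by blast
qed

subsection \<open>The lower bound\<close>

definition increasing_pairs :: "nat set \<Rightarrow> (nat \<times> nat) set" where
  "increasing_pairs a = {(i, j). i \<in> a \<and> j \<in> a \<and> i < j}"

lemma finite_increasing_pairs: "finite a \<Longrightarrow> finite (increasing_pairs a)"
  by (rule finite_subset[of _ "a \<times> a"]) (auto simp: increasing_pairs_def)

text \<open>The pairs that begin with \<open>Min a\<close> suffice.\<close>

lemma card_le_card_increasing_pairs:
  assumes "finite a"
  shows "card a \<le> Suc (card (increasing_pairs a))"
proof (cases "a = {}")
  case False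
  then have "Min a \<in> a" and "\<And>j. j \<in> a - {Min a} \<Longrightarrow> Min a < j"
    using assms by (auto simp: less_le)
  then have "(\<lambda>j. (Min a, j)) ` (a - {Min a}) \<subseteq> increasing_pairs a"
    by (auto simp: increasing_pairs_def)
  then have "card ((\<lambda>j. (Min a, j)) ` (a - {Min a})) \<le> card (increasing_pairs a)"
    using finite_increasing_pairs[OF assms] by (rule card_mono[rotated])
  moreover have "card ((\<lambda>j. (Min a, j)) ` (a - {Min a})) = card (a - {Min a})"
    by (intro card_image inj_onI) auto
  ultimately show ?thesis using assms \<open>Min a \<in> a\<close> by simp
qed simp

lemma sum_of_bool_swap:
  assumes "finite F" "finite A"
  shows "(\<Sum>e\<in>F. \<Sum>x\<in>A. of_bool (e = f x)) = real (card {x \<in> A. f x \<in> F})"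
proof -
  have "(\<Sum>e\<in>F. \<Sum>x\<in>A. of_bool (e = f x)) = (\<Sum>x\<in>A. \<Sum>e\<in>F. of_bool (e = f x) :: real)"
    by (rule sum.swap)
  also have "\<dots> = (\<Sum>x\<in>A. of_bool (f x \<in> F))"
    using assms(1) by (intro sum.cong) (simp_all add: of_bool_def)
  also have "\<dots> = real (card {x \<in> A. f x \<in> F})"
    using assms(2) by (simp add: Int_def)
  finally show ?thesis .
qed

lemma finite_complete_edges: "finite (complete_edges n)"
  by (rule finite_subset[of _ "Pow {..<n}"]) (auto simp: complete_edges_def)

lemma char_vec_coord_space: "finite I \<Longrightarrow> F \<subseteq> I \<Longrightarrow> char_vec F \<in> coord_space I"
  by (auto simp: coord_space_def in_keys_iff lookup_char_vec finite_subset split: if_splits)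

lemma pairing_char_vec:
  assumes "finite I" "F \<subseteq> I"
  shows "pairing I c (char_vec F) = sum c F"
proof -
  have "finite F" using assms finite_subset by blast
  then have "pairing I c (char_vec F) = (\<Sum>e\<in>I. if e \<in> F then c e else 0)"
    unfolding pairing_def by (intro sum.cong) (simp_all add: lookup_char_vec)
  also have "\<dots> = sum c (I \<inter> F)" by (rule sum.inter_restrict[OF assms(1), symmetric])
  finally show ?thesis using assms(2) by (simp add: Int_absorb1)
qed

section \<open>Inequalities and tours on the numbered vertices\<close>

locale gadget_embedding =
  fixes k p n :: nat and code :: "vertex \<Rightarrow> nat"
  assumes code: "bij_betw code (verts k p) {..<n}" and n: "n \<ge> 3" and k: "k > 0"
begin

definition edge :: "vertex \<Rightarrow> vertex \<Rightarrow> nat set" where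
  "edge u v = {code u, code v}"

definition neighbours :: "nat set set \<Rightarrow> vertex \<Rightarrow> vertex set" where
  "neighbours F u = {v \<in> verts k p. edge u v \<in> F}"

lemma edge_commute: "edge u v = edge v u"
  by (auto simp: edge_def)

lemma code_image_neighbours:
  assumes "is_tour n F" "u \<in> verts k p"
  shows "code ` neighbours F u = {w. {code u, w} \<in> F}"
proof -
  have "code u < n" using code assms(2) by (auto simp: bij_betw_def)
  then have "w \<in> code ` verts k p" if "{code u, w} \<in> F" for w
    using card_tour_neighbours(2)[OF assms(1)] code that by (auto simp: bij_betw_def)
  then show ?thesis by (auto simp: neighbours_def edge_def)
qed

lemma two_factor_neighbours:
  assumes "is_tour n F"
  shows "two_factor k p (neighbours F)"
proof
  show "card (neighbours F u) = 2" if u: "u \<in> verts k p" for u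
  proof -
    have "code u < n" using code u by (auto simp: bij_betw_def)
    moreover have "inj_on code (neighbours F u)"
      using code by (auto simp: bij_betw_def neighbours_def intro: inj_on_subset)
    ultimately show ?thesis
      using card_image code_image_neighbours[OF assms u] card_tour_neighbours(1)[OF assms] by metis
  qed
  show "u \<in> neighbours F v" if "u \<in> verts k p" "v \<in> neighbours F u" for u v
    using that by (auto simp: neighbours_def edge_commute)
qed

definition required :: "nat set set" where
  "required = (\<lambda>(i, l). edge (Enter i l) (Exit l i)) ` ({..<k} \<times> {..<k}) \<union>
     (\<lambda>g. edge (Junc_in g) (Junc_out g)) ` {..k * k}"

text \<open>\<open>allowed\<close> is not symmetric; since both orders of \<open>u\<close> and
  \<open>v\<close> occur, an edge is bad as soon as one end forbids it.\<close>

definition bad :: "nat set set" where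
  "bad = {edge u v | u v. u \<in> verts k p \<and> v \<in> verts k p \<and> v \<notin> allowed k u}"

lemma finite_required: "finite required"
  by (simp add: required_def)

text \<open>Connectivity holds because a tour crosses every cut.\<close>

lemma regular_tour_neighbours:
  assumes "is_tour n F" "required \<subseteq> F" "F \<inter> bad = {}"
  shows "regular_tour k p (neighbours F)"
proof -
  interpret two_factor k p "neighbours F" by (rule two_factor_neighbours) fact
  show ?thesis
  proof
    show "neighbours F u \<subseteq> allowed k u" if "u \<in> verts k p" for u
      using assms(3) that by (auto simp: neighbours_def bad_def)
    show "Exit l i \<in> neighbours F (Enter i l)" if "i < k" "l < k" for i l
      using assms(2) that by (force simp: neighbours_def required_def)
    show "Junc_out g \<in> neighbours F (Junc_in g)" if "g \<le> k * k" for g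
      using assms(2) that by (force simp: neighbours_def required_def)
  next
    fix W assume W: "W \<subset> verts k p" "W \<noteq> {}"
    have "code ` W \<subset> {..<n}"
    proof -
      have "inj_on code (verts k p)" "code ` verts k p = {..<n}" using code by (auto simp: bij_betw_def)
      then show ?thesis using image_strict_mono[of code, OF _ W(1)] by metis
    qed
    then obtain x y where xy: "x \<in> code ` W" "y \<in> {..<n} - code ` W" "{x, y} \<in> F"
      using tour_crosses_cut[OF assms(1), of "code ` W"] W(2) by blast
    then obtain u where u: "u \<in> W" "x = code u" by blast
    then have "y \<in> code ` neighbours F u" using xy(3) code_image_neighbours[OF assms(1), of u] W(1) by auto
    then have "\<not> neighbours F u \<subseteq> W" using xy(2) by auto
    then show "\<exists>u\<in>W. \<not> neighbours F u \<subseteq> W" using u by blast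
  qed
qed

definition start_edge :: "nat \<Rightarrow> nat set" where
  "start_edge i = edge (Start i) (Enter i 0)"

definition escape_edge :: "nat \<times> nat \<Rightarrow> nat set" where
  "escape_edge q = edge (Enter (fst q) (snd q)) (Junc_out (fst q * k + snd q))"

text \<open>
  With \<open>u i\<close>, \<open>y i j\<close> the variables of the start and escape edges, this is
  \<open>\<Sum>i\<in>a. (1 - u i) - \<Sum>i<j\<in>a. y i j \<le> 1\<close>, relaxed by the penalty \<open>card a\<close> for each required edge
  not used and each bad edge used.
\<close>

definition cost :: "nat set \<Rightarrow> nat set \<Rightarrow> real" where
  "cost a e = real (card a) * (of_bool (e \<in> required) - of_bool (e \<in> bad)) -
     (\<Sum>i\<in>a. of_bool (e = start_edge i)) - (\<Sum>q\<in>increasing_pairs a. of_bool (e = escape_edge q))"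

text \<open>If all required edges and no bad ones are used, a cost of at most \<open>bound a\<close>
  means that \<open>card a\<close> is at most 1 plus the number of start and escape edges of
  \<open>a\<close> in the tour.\<close>

definition bound :: "nat set \<Rightarrow> real" where
  "bound a = real (card a) * real (card required) - real (card a) + 1"

lemma sum_cost:
  assumes "finite F" "finite a"
  shows "sum (cost a) F =
    real (card a) * (real (card (F \<inter> required)) - real (card (F \<inter> bad))) -
    real (card {i \<in> a. start_edge i \<in> F}) - real (card {q \<in> increasing_pairs a. escape_edge q \<in> F})"
proof -
  have "(\<Sum>e\<in>F. \<Sum>i\<in>a. of_bool (e = start_edge i)) = real (card {i \<in> a. start_edge i \<in> F})"
    "(\<Sum>e\<in>F. \<Sum>q\<in>increasing_pairs a. of_bool (e = escape_edge q)) =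
      real (card {q \<in> increasing_pairs a. escape_edge q \<in> F})"
    using assms finite_increasing_pairs by (intro sum_of_bool_swap; simp)+
  moreover have "(\<Sum>e\<in>F. real (card a) * (of_bool (e \<in> required) - of_bool (e \<in> bad))) =
      real (card a) * (real (card (F \<inter> required)) - real (card (F \<inter> bad)))"
    using assms by (simp add: sum_distrib_left[symmetric] sum_subtractf)
  ultimately show ?thesis by (simp add: cost_def sum_subtractf)
qed

text \<open>In a regular tour any two variables of \<open>a\<close> with value 1 force an escape
  edge, and \<open>m\<close> variables have at least \<open>m - 1\<close> pairs. Every other tour
  pays the penalty \<open>card a\<close> at least once, which is enough by itself.\<close>

lemma cost_le_bound:
  assumes F: "is_tour n F" "F \<subseteq> complete_edges n" and a: "a \<subseteq> {..<k}"
  shows "sum (cost a) F \<le> bound a"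
proof -
  have fin: "finite F" "finite a"
    using F(2) finite_complete_edges a finite_subset by blast+
  show ?thesis
  proof (cases "required \<subseteq> F \<and> F \<inter> bad = {}")
    case True
    then interpret regular_tour k p "neighbours F" using regular_tour_neighbours F(1) by blast
    define c where "c = {i \<in> a. start_edge i \<notin> F}"
    have start: "start_edge i \<in> F \<longleftrightarrow> Start i \<in> neighbours F (Enter i 0)" if "i < k" for i
      using that k by (simp add: neighbours_def start_edge_def edge_commute)
    have "increasing_pairs c \<subseteq> {q \<in> increasing_pairs a. escape_edge q \<in> F}"
    proof
      fix q assume "q \<in> increasing_pairs c"
      then obtain i j where q: "q = (i, j)" "i \<in> c" "j \<in> c" "i < j"
        by (auto simp: increasing_pairs_def)
      then have "i < k" "j < k" "i \<in> a" "j \<in> a" using a by (auto simp: c_def)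
      then have "Junc_out (i * k + j) \<in> neighbours F (Enter i j)"
        using both_rows_off[of i j] q start by (simp add: c_def)
      then show "q \<in> {q \<in> increasing_pairs a. escape_edge q \<in> F}"
        using q \<open>i \<in> a\<close> \<open>j \<in> a\<close> by (simp add: escape_edge_def neighbours_def increasing_pairs_def)
    qed
    then have "card (increasing_pairs c) \<le> card {q \<in> increasing_pairs a. escape_edge q \<in> F}"
      using finite_increasing_pairs[OF fin(2)] by (intro card_mono) auto
    moreover have "card c \<le> Suc (card (increasing_pairs c))"
      using fin(2) by (intro card_le_card_increasing_pairs) (simp add: c_def)
    moreover have "card a = card {i \<in> a. start_edge i \<in> F} + card c"
    proof -
      have "a = {i \<in> a. start_edge i \<in> F} \<union> c" by (auto simp: c_def)
      then show ?thesis using fin(2) card_Un_disjoint[of "{i \<in> a. start_edge i \<in> F}" c] by (auto simp: c_def)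
    qed
    ultimately have "real (card a) \<le> real (card {i \<in> a. start_edge i \<in> F}) +
        (1 + real (card {q \<in> increasing_pairs a. escape_edge q \<in> F}))"
      by linarith
    then show ?thesis using True by (simp add: sum_cost[OF fin] bound_def Int_absorb1)
  next
    case False
    have "real (card (F \<inter> required)) - real (card (F \<inter> bad)) \<le> real (card required) - 1"
    proof (cases "required \<subseteq> F")
      case True
      then have "card (F \<inter> bad) \<noteq> 0" using False fin(1) by simp
      then show ?thesis using True by (simp add: Int_absorb1)
    next
      case False
      then have "F \<inter> required \<subset> required" by blast
      then have "card (F \<inter> required) < card required" by (rule psubset_card_mono[OF finite_required])
      then show ?thesis by linarith
    qed
    then have "real (card a) * (real (card (F \<inter> required)) - real (card (F \<inter> bad))) \<le>
        real (card a) * (real (card required) - 1)"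
      by (rule mult_left_mono) simp
    then show ?thesis by (simp add: sum_cost[OF fin] bound_def algebra_simps)
  qed
qed

text \<open>One tour serves all \<open>a\<close>. With \<open>m = card (a \<inter> b)\<close> its
  slack \<open>bound a - sum (cost a) F\<close> is \<open>1 - m + m * (m - 1) / 2\<close>, that is
  \<open>(m - 1) * (m - 2) / 2\<close>: 1 for disjoint sets and 0 for \<open>m = 1\<close>.\<close>

lemma followed_tour_exists:
  obtains F where "is_tour n F" "F \<subseteq> complete_edges n"
    "\<And>a. a \<subseteq> {..<k} \<Longrightarrow> sum (cost a) F =
       real (card a) * real (card required) - real (card (a - b)) - real (card (increasing_pairs (a \<inter> b)))"
proof -
  obtain L where L: "distinct L" "set L = verts k p" "successively (related k b) L"
    "related k b (last L) (hd L)"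
    using followed_cycle_exists[OF k] by blast
  obtain F where F: "is_tour n F" "F \<subseteq> complete_edges n"
    and rel: "\<And>u v. u \<in> verts k p \<Longrightarrow> v \<in> verts k p \<Longrightarrow> {code u, code v} \<in> F \<Longrightarrow> related k b u v"
    using tour_of_list[OF n code L related_sym] by blast
  have followed: "neighbours F u \<subseteq> followed k b u" if "u \<in> verts k p" for u
    using rel that by (auto simp: neighbours_def edge_def related_def)
  interpret two_factor k p "neighbours F" using two_factor_neighbours F(1) .
  interpret followed_tour k p "neighbours F" b by unfold_locales (rule followed)
  have "required \<subseteq> F"
    using rung junction[OF _ k] by (auto simp: required_def neighbours_def)
  moreover have "F \<inter> bad = {}"
  proof -
    have "v \<in> allowed k u" if "u \<in> verts k p" "v \<in> verts k p" "edge u v \<in> F" for u v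
      using followed[OF that(1)] followed_subset_allowed[of k b u] that by (auto simp: neighbours_def)
    then show ?thesis by (auto simp: bad_def)
  qed
  moreover have "{i \<in> a. start_edge i \<in> F} = a - b" if "a \<subseteq> {..<k}" for a
  proof -
    have "start_edge i \<in> F \<longleftrightarrow> i \<notin> b" if "i < k" for i
      using start_iff[OF that] that k by (simp add: neighbours_def start_edge_def edge_commute)
    then show ?thesis using that by auto
  qed
  moreover have "{q \<in> increasing_pairs a. escape_edge q \<in> F} = increasing_pairs (a \<inter> b)" if "a \<subseteq> {..<k}" for a
  proof -
    have "escape_edge (i, j) \<in> F \<longleftrightarrow> i \<in> b \<and> j \<in> b" if "i < j" "j < k" for i j
      using escape_iff[OF that] that pair_index(3)[of i k j] by (simp add: neighbours_def escape_edge_def)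
    then show ?thesis using that by (auto simp: increasing_pairs_def)
  qed
  moreover have "finite F" using F(2) finite_complete_edges finite_subset by blast
  ultimately have "sum (cost a) F = real (card a) * real (card required) - real (card (a - b)) -
      real (card (increasing_pairs (a \<inter> b)))" if "a \<subseteq> {..<k}" for a
    using that finite_subset[OF that] by (simp add: sum_cost Int_absorb1)
  then show thesis using that F by blast
qed

lemma extended_formulation_size:
  assumes EF: "extended_formulation (complete_edges n) (TSP n) S"
  shows "(3 / 2) ^ k \<le> real (num_ineq S) + 1"
proof -
  let ?I = "complete_edges n"
  define T where "T b = (SOME F. is_tour n F \<and> F \<subseteq> ?I \<and> (\<forall>a\<subseteq>{..<k}. sum (cost a) F =
    real (card a) * real (card required) - real (card (a - b)) - real (card (increasing_pairs (a \<inter> b)))))" for b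
  have "is_tour n (T b) \<and> T b \<subseteq> ?I \<and> (\<forall>a\<subseteq>{..<k}. sum (cost a) (T b) =
    real (card a) * real (card required) - real (card (a - b)) - real (card (increasing_pairs (a \<inter> b))))" for b
    unfolding T_def by (rule someI_ex) (use followed_tour_exists[of b] in metis)
  then have T: "is_tour n (T b)" "T b \<subseteq> ?I" and T_cost: "a \<subseteq> {..<k} \<Longrightarrow> sum (cost a) (T b) =
    real (card a) * real (card required) - real (card (a - b)) - real (card (increasing_pairs (a \<inter> b)))" for a b
    by blast+
  have val: "pairing ?I (cost a) (char_vec (T b)) = sum (cost a) (T b)" for a b
    using pairing_char_vec[OF finite_complete_edges T(2)] .
  have tight: "pairing ?I (cost a) (char_vec (T b)) = bound a" if a: "a \<subseteq> {..<k}" "card (a \<inter> b) = 1" for a b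
  proof -
    obtain x where x: "a \<inter> b = {x}" using a(2) card_1_singletonE by blast
    then have "increasing_pairs (a \<inter> b) = {}" by (auto simp: increasing_pairs_def)
    moreover have "finite a" using a(1) finite_subset by blast
    moreover have "a - b = a - {x}" "x \<in> a" using x by auto
    ultimately show ?thesis
      using T_cost[OF a(1), of b] card_Suc_Diff1[of a x] by (simp add: val bound_def flip: of_nat_Suc)
  qed
  have loose: "pairing ?I (cost a) (char_vec (T b)) < bound a" if "a \<subseteq> {..<k}" "a \<inter> b = {}" for a b
  proof -
    have "increasing_pairs (a \<inter> b) = {}" "a - b = a" using that by (auto simp: increasing_pairs_def)
    then show ?thesis using T_cost[OF that(1), of b] by (simp add: val bound_def)
  qed
  have valid: "pairing ?I (cost a) x \<le> bound a" if "a \<in> Pow {..<k}" "x \<in> TSP n \<inter> coord_space ?I" for a x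
  proof (rule pairing_le_convex_hull)
    show "x \<in> convex hull {char_vec F | F. F \<subseteq> ?I \<and> is_tour n F}" using that(2) by (simp add: TSP_def)
    show "pairing ?I (cost a) y \<le> bound a" if "y \<in> {char_vec F | F. F \<subseteq> ?I \<and> is_tour n F}" for y
      using that cost_le_bound \<open>a \<in> Pow {..<k}\<close> pairing_char_vec[OF finite_complete_edges] by auto
  qed
  have points: "char_vec (T b) \<in> TSP n \<inter> coord_space ?I" for b
  proof
    show "char_vec (T b) \<in> TSP n" unfolding TSP_def using T by (intro hull_inc) blast
    show "char_vec (T b) \<in> coord_space ?I" using char_vec_coord_space[OF finite_complete_edges T(2)] .
  qed
  obtain R C where RC: "\<And>j. R j \<subseteq> Pow {..<k}" "\<And>j. C j \<subseteq> Pow {..<k}"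
    "\<And>j a b. a \<in> R j \<Longrightarrow> b \<in> C j \<Longrightarrow> pairing ?I (cost a) (char_vec (T b)) < bound a"
    "\<And>a b b'. a \<in> Pow {..<k} \<Longrightarrow> b \<in> Pow {..<k} \<Longrightarrow> b' \<in> Pow {..<k} \<Longrightarrow>
       pairing ?I (cost a) (char_vec (T b)) < bound a \<Longrightarrow>
       pairing ?I (cost a) (char_vec (T b')) = bound a \<Longrightarrow> \<exists>j<num_ineq S. a \<in> R j \<and> b \<in> C j"
  proof (rule extended_formulation_rectangles[where A = "Pow {..<k}" and B = "Pow {..<k}"
        and v = "\<lambda>b. char_vec (T b)" and c = cost and \<beta> = bound, OF EF], goal_cases)
    case (4 R C)
    show ?case by (rule 4(1)[OF 4(2-5)])
  qed (use points valid in auto)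
  define m where "m = num_ineq S"
  \<comment> \<open>The inequality for \<open>a = {}\<close> is tight at no tour, so these pairs need a rectangle of their own.\<close>
  have "(3 / 2) ^ card {..<k} \<le> real (card {..m})"
  proof (rule rectangle_cover_lower_bound[where R = "R(m := {{}})" and C = "C(m := Pow {..<k})"])
    show "(R(m := {{}})) j \<subseteq> Pow {..<k}" "(C(m := Pow {..<k})) j \<subseteq> Pow {..<k}" for j
      using RC(1,2) by auto
    show "card (a \<inter> b) \<noteq> 1" if "a \<in> (R(m := {{}})) j" "b \<in> (C(m := Pow {..<k})) j" for j a b
    proof (cases "j = m")
      case False
      then show ?thesis using that RC(1)[of j] RC(3)[of a j b] tight[of a b] by auto
    qed (use that in simp)
    show "\<exists>j\<in>{..m}. a \<in> (R(m := {{}})) j \<and> b \<in> (C(m := Pow {..<k})) j"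
      if ab: "a \<subseteq> {..<k}" "b \<subseteq> {..<k}" "a \<inter> b = {}" for a b
    proof (cases "a = {}")
      case False
      then obtain x where "x \<in> a" by blast
      \<comment> \<open>The tour of \<open>{x}\<close> is tight for \<open>a\<close>, as the
        covering requires.\<close>
      then have "\<exists>j<num_ineq S. a \<in> R j \<and> b \<in> C j"
        using ab tight[of a "{x}"] by (intro RC(4)[of a b "{x}"] loose) auto
      then obtain j where "j < m" "a \<in> R j" "b \<in> C j" by (auto simp: m_def)
      then show ?thesis by (intro bexI[of _ j]) auto
    qed (use ab in auto)
  qed auto
  then show ?thesis by (simp add: m_def)
qed

end

section \<open>Choice of \<open>k\<close> and the asymptotic bound\<close>

lemma TSP_extended_formulation_size:
  assumes "k > 0" "4 * k\<^sup>2 + k + 2 \<le> n" "extended_formulation (complete_edges n) (TSP n) S"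
  shows "(3 / 2) ^ k \<le> real (num_ineq S) + 1"
proof -
  define p where "p = n - (4 * k\<^sup>2 + k + 2)"
  have "card (verts k p) = card {..<n}" using assms(2) by (simp add: card_verts p_def)
  then obtain code where "bij_betw code (verts k p) {..<n}"
    using finite_same_card_bij[OF finite_verts finite_lessThan] by blast
  moreover have "n \<ge> 3" using assms(1,2) by linarith
  ultimately interpret gadget_embedding k p n code using assms(1) by unfold_locales
  show ?thesis by (rule extended_formulation_size) fact
qed

text \<open>\<open>LEAST\<close> is informative only if some system exists. The formulation by
  convex weights provides one, so a bound for all systems carries over to the minimum.\<close>

lemma extension_complexity_attained:
  "\<exists>S. extended_formulation (complete_edges n) (TSP n) S \<and>
     num_ineq S = extension_complexity (complete_edges n) (TSP n)"
proof -
  let ?V = "{char_vec F | F. F \<subseteq> complete_edges n \<and> is_tour n F}"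
  have "?V \<subseteq> char_vec ` Pow (complete_edges n)" by blast
  then have "finite ?V" using finite_complete_edges finite_subset by blast
  moreover have "?V \<subseteq> coord_space (complete_edges n)"
    using char_vec_coord_space[OF finite_complete_edges] by blast
  ultimately obtain S where "extended_formulation (complete_edges n) (TSP n) S"
    using extended_formulation_convex_hull[OF finite_complete_edges] unfolding TSP_def by blast
  then have "\<exists>m S. extended_formulation (complete_edges n) (TSP n) S \<and> num_ineq S = m" by blast
  then show ?thesis unfolding extension_complexity_def by (rule LeastI_ex)
qed

theorem theorem12:
  shows "\<exists>c::real. c > 0 \<and>
    (\<forall>\<^sub>F n in sequentially.
       2 powr (c * sqrt (real n)) \<le> real (extension_complexity (complete_edges n) (TSP n)))"
proof (intro exI conjI)
  \<comment> \<open>The constant comes from \<open>k \<ge> s / 4\<close>, from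
    \<open>(3 / 2) ^ k \<ge> sqrt 2 ^ k\<close> and from a further halving of the exponent that
    absorbs the summand 1.\<close>
  show "(0::real) < 1 / 16" by simp
  show "\<forall>\<^sub>F n in sequentially.
      2 powr (1 / 16 * sqrt (real n)) \<le> real (extension_complexity (complete_edges n) (TSP n))"
    \<comment> \<open>From 256 on, \<open>s \<ge> 16\<close>, which is enough for
      \<open>4 * k\<^sup>2 + k + 2 \<le> n\<close> and for \<open>z \<ge> 2\<close>.\<close>
    using eventually_ge_at_top[of 256]
  proof eventually_elim
    case (elim n)
    define s where "s = sqrt (real n)"
    \<comment> \<open>The divisor 3 keeps \<open>4 * k\<^sup>2\<close> below
      \<open>4 * n / 9\<close>, leaving room for the lower-order terms.\<close>
    define k where "k = nat \<lfloor>s / 3\<rfloor>"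
    have "sqrt 256 \<le> s" unfolding s_def using elim by (intro real_sqrt_le_mono) simp
    then have s: "s \<ge> 16" by simp
    have k: "real k \<le> s / 3" "s / 3 < real k + 1" using s unfolding k_def by linarith+
    then have "k > 0" "s / 4 \<le> real k" using s by (auto intro: gr0I)
    have "real (4 * k\<^sup>2 + k + 2) = 4 * (real k)\<^sup>2 + real k + 2" by simp
    also have "\<dots> \<le> 4 * (s / 3)\<^sup>2 + s / 3 + 2"
      using k(1) by (intro add_mono mult_left_mono power_mono) auto
    also have "\<dots> \<le> s\<^sup>2"
    proof -
      have "16 * s \<le> s\<^sup>2" using s by (simp add: power2_eq_square)
      then show ?thesis using s by (simp add: power_divide)
    qed
    also have "\<dots> = real n" by (simp add: s_def)
    finally have "4 * k\<^sup>2 + k + 2 \<le> n" by linarith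
    then have *: "(3 / 2) ^ k \<le> real (extension_complexity (complete_edges n) (TSP n)) + 1"
      using extension_complexity_attained[of n] TSP_extended_formulation_size[OF \<open>k > 0\<close>] by metis
    define z where "z = 2 powr (1 / 16 * s)"
    have "z \<ge> 2 powr 1" unfolding z_def using s by (intro powr_mono) auto
    then have "z \<ge> 2" by simp
    then have "z + 1 \<le> z * z" using mult_right_mono[of 2 z z] by linarith
    also have "\<dots> = 2 powr (s / 8)" by (simp add: z_def flip: powr_add)
    also have "\<dots> \<le> 2 powr (real k / 2)" using \<open>s / 4 \<le> real k\<close> by (intro powr_mono) auto
    also have "\<dots> = sqrt 2 ^ k" by (simp add: powr_half_sqrt[symmetric] powr_powr flip: powr_realpow)
    also have "\<dots> \<le> (3 / 2) ^ k" by (intro power_mono real_le_lsqrt) (auto simp: power2_eq_square)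
    finally have "z \<le> real (extension_complexity (complete_edges n) (TSP n))" using * by linarith
    then show ?case by (simp add: z_def s_def)
  qed
qed

end
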